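(* Let $\mathbb{F}\in\{\mathbb{R},\mathbb{C}\}$, let $N\ge2$, $M\ge2$ and $Q$ be integers with $1\le Q\le M-1$, write $\mathcal{M}=\{1,\dots,M\}$, and let $\mathbf{H}_1,\dots,\mathbf{H}_M$ be $N\times N$ positive semidefinite matrices (real symmetric if $\mathbb{F}=\mathbb{R}$, Hermitian if $\mathbb{F}=\mathbb{C}$). Take $\epsilon=0$. Let $v^{\min}_{\rm QP}$ be the optimal value of (P1): minimize $\|\mathbf{w}\|^2$ over $\mathbf{w}\in\mathbb{F}^N$, $\boldsymbol\beta\in\{0,1\}^M$ subject to $\mathbf{w}^H\mathbf{H}_i\mathbf{w}\ge\beta_i$ ($i\in\mathcal{M}$) and $\sum_i\beta_i=Q$; and let $v^{\min}_{\rm SDP2}$ be the optimal value of (SDP2): minimize $\mathrm{Tr}[\mathbf{X}]$ over $N\times N$ matrices $\mathbf{X}\succeq0$ (real symmetric if $\mathbb{F}=\mathbb{R}$, Hermitian if $\mathbb{F}=\mathbb{C}$) and $\boldsymbol\beta\in\mathbb{R}^M$ subject to $\mathrm{Tr}[\mathbf{H}_i\mathbf{X}]\ge\beta_i$ ($i\in\mathcal{M}$), $\sum_i\beta_i=Q$, $0\le\beta_i\le1$. Then $$v^{\min}_{\rm QP}\le\frac{27Q^2(M-Q+1)}{\pi}\,v^{\min}_{\rm SDP2}\quad\text{when }\mathbb{F}=\mathbb{R},$$ and $$v^{\min}_{\rm QP}\le\max\{8Q,\ 24(\sqrt{Q}-1)^2\}\,(M-Q+1)\,v^{\min}_{\rm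 SDP2}\quad\text{when }\mathbb{F}=\mathbb{C}.$$
   Context: ${}^H$ denotes conjugate transpose (ordinary transpose in the real case). *)

theory Defs
  imports "HOL-Analysis.Analysis"
begin

definition psd_real :: "real^'n^'n \<Rightarrow> bool" where
  "psd_real A \<longleftrightarrow> transpose A = A \<and> (\<forall>x. x \<bullet> (A *v x) \<ge> 0)"

definition cform :: "complex^'n^'n \<Rightarrow> complex^'n \<Rightarrow> complex" where
  "cform A w = (\<Sum>i\<in>UNIV. \<Sum>j\<in>UNIV. cnj (w $ i) * A $ i $ j * w $ j)"

definition hermitian :: "complex^'n^'n \<Rightarrow> bool" where
  "hermitian A \<longleftrightarrow> (\<forall>i j. A $ i $ j = cnj (A $ j $ i))"

definition psd_complex :: "complex^'n^'n \<Rightarrow> bool" where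
  "psd_complex A \<longleftrightarrow> hermitian A \<and> (\<forall>x. Im (cform A x) = 0 \<and> Re (cform A x) \<ge> 0)"

section \<open>Optimal values (infima in the extended reals; +\<infinity> if infeasible)\<close>

definition vQP_real :: "nat \<Rightarrow> nat \<Rightarrow> (nat \<Rightarrow> real^'n^'n) \<Rightarrow> ereal" where
  "vQP_real M Q H = Inf { ereal ((norm w)^2) | w \<beta>.
      (\<forall>i\<in>{1..M}. \<beta> i \<in> {0,1} \<and> w \<bullet> (H i *v w) \<ge> \<beta> i) \<and> (\<Sum>i=1..M. \<beta> i) = real Q }"

definition vSDP2_real :: "nat \<Rightarrow> nat \<Rightarrow> (nat \<Rightarrow> real^'n^'n) \<Rightarrow> ereal" where
  "vSDP2_real M Q H = Inf { ereal (trace X) | X \<beta>. psd_real X \<and>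
      (\<forall>i\<in>{1..M}. 0 \<le> \<beta> i \<and> \<beta> i \<le> 1 \<and> trace (H i ** X) \<ge> \<beta> i) \<and> (\<Sum>i=1..M. \<beta> i) = real Q }"

definition vQP_complex :: "nat \<Rightarrow> nat \<Rightarrow> (nat \<Rightarrow> complex^'n^'n) \<Rightarrow> ereal" where
  "vQP_complex M Q H = Inf { ereal ((norm w)^2) | w \<beta>.
      (\<forall>i\<in>{1..M}. \<beta> i \<in> {0,1} \<and> Re (cform (H i) w) \<ge> \<beta> i) \<and> (\<Sum>i=1..M. \<beta> i) = real Q }"

definition vSDP2_complex :: "nat \<Rightarrow> nat \<Rightarrow> (nat \<Rightarrow> complex^'n^'n) \<Rightarrow> ereal" where
  "vSDP2_complex M Q H = Inf { ereal (Re (trace X)) | X \<beta>. psd_complex X \<and>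
      (\<forall>i\<in>{1..M}. 0 \<le> \<beta> i \<and> \<beta> i \<le> 1 \<and> Re (trace (H i ** X)) \<ge> \<beta> i) \<and> (\<Sum>i=1..M. \<beta> i) = real Q }"

end

theory Submission
  imports Defs "HOL-Probability.Probability"
begin

text \<open>
  Since the \<open>\<beta>\<^sub>i \<le> 1\<close> sum to \<open>Q\<close>, at least \<open>Q\<close> of them are \<open>\<ge> 1 / (M - Q + 1)\<close>, so it suffices to find,
  for \<open>Q\<close> positive semidefinite \<open>H\<^sub>i\<close> and a feasible \<open>X\<close>, a vector \<open>w\<close> with
  \<open>Tr(H\<^sub>i X) |w|\<^sup>2 < \<kappa> Tr(X) w\<^sup>H H\<^sub>i w\<close> for all these \<open>i\<close>, and to rescale it.
  Take \<open>w\<close> Gaussian with covariance \<open>X\<close>, and put \<open>S\<^sub>i = w\<^sup>H H\<^sub>i w / Tr(H\<^sub>i X)\<close> and \<open>T = |w|\<^sup>2 / Tr(X)\<close>, the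
  latter halved in the complex case.
  If no \<open>w\<close> works, then \<open>\<Sum>\<^sub>i exp (s T - t S\<^sub>i) \<ge> 1\<close> everywhere, where \<open>\<kappa>\<close> is \<open>t / s\<close> or \<open>2 t / s\<close>.
  But \<open>E exp (s T - t S\<^sub>i) \<le> (1 - 2 s)\<^bsup>-1/2\<^esup> (1 + 2 t)\<^bsup>-d/2\<^esup>\<close> with \<open>d = 1\<close> over the reals and \<open>d = 2\<close> over
  the complex numbers: by convexity of \<open>exp\<close> both quadratic forms may be taken of rank one, and
  then the substitution \<open>x \<mapsto> x + c (a \<bullet> x) a\<close> removes one direction at a time.
  With \<open>s = 3/8\<close> and \<open>t = 2 Q\<^sup>2\<close> (real) or \<open>t = Q\<close> (complex) the sum of the \<open>Q\<close> expectations is below \<open>1\<close>,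
  which gives \<open>\<kappa> = 16/3 Q\<^sup>2\<close> and \<open>\<kappa> = 16/3 Q\<close>, smaller than \<open>27 Q\<^sup>2 / \<pi>\<close> and \<open>8 Q\<close>.
\<close>

section \<open>Gaussian integrals\<close>

text \<open>An orthogonal map carrying a coordinate vector to \<open>a\<close> conjugates this
  perturbation of the identity to a diagonal matrix with the single exceptional entry
  \<open>1 + c\<close>.\<close>

lemma det_rank_one_perturbation:
  fixes a :: "real^'n"
  assumes "norm a = 1"
  shows "det (matrix (\<lambda>x. x + (c * (a \<bullet> x)) *\<^sub>R a)) = 1 + c"
proof -
  \<comment> \<open>Any index serves; \<open>k\<close> only singles out a coordinate direction to
    rotate onto \<open>a\<close>.\<close>
  obtain k :: 'n where True by simp
  let ?e = "axis k 1 :: real^'n"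
  obtain f :: "real^'n \<Rightarrow> real^'n" where f: "orthogonal_transformation f" "f ?e = a"
    using orthogonal_transformation_exists_1[of ?e a] assms by (auto simp: norm_axis_1)
  let ?g = "\<lambda>x. x + (c * (?e \<bullet> x)) *\<^sub>R ?e"
  let ?h = "\<lambda>x. x + (c * (a \<bullet> x)) *\<^sub>R a"
  have lin: "linear f" "linear ?g" "linear ?h"
    using f(1) by (auto simp: orthogonal_transformation_def intro!: linearI simp: algebra_simps)
  have "?h \<circ> f = f \<circ> ?g"
  proof
    fix x
    have "a \<bullet> f x = ?e \<bullet> x"
      using f by (metis orthogonal_transformation_def)
    then show "(?h \<circ> f) x = (f \<circ> ?g) x"
      using f(2) lin(1) by (simp add: linear_add linear_scale)
  qed
  then have "matrix ?h ** matrix f = matrix f ** matrix ?g"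
    using matrix_compose[OF lin(1) lin(3)] matrix_compose[OF lin(2) lin(1)] by simp
  then have "det (matrix ?h) * det (matrix f) = det (matrix f) * det (matrix ?g)"
    by (simp only: det_mul[symmetric])
  moreover have "det (matrix f) \<noteq> 0"
    using orthogonal_transformation_det[OF f(1)] by auto
  moreover have "det (matrix ?g) = 1 + c"
  proof -
    have entry: "matrix ?g $ i $ j = (if i = j then (if i = k then 1 + c else 1) else 0)" for i j
      by (simp add: matrix_def inner_axis_axis) (simp add: axis_def)
    have "det (matrix ?g) = (\<Prod>i\<in>UNIV. if i = k then 1 + c else 1)"
      by (subst det_diagonal) (simp_all add: entry)
    then show ?thesis by simp
  qed
  ultimately show ?thesis by simp
qed

text \<open>This is the linear change of variables with determinant \<open>1 + c\<close>. The
  hypothesis \<open>c > -1\<close> makes the map invertible and the determinant positive, so no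
  absolute value appears.\<close>

lemma nn_integral_rank_one_substitution:
  fixes a :: "real^'m::{finite,wellorder}" and f :: "real^'m::_ \<Rightarrow> ennreal"
  assumes "norm a = 1" "c > -1" and [measurable]: "f \<in> borel_measurable borel"
  shows "(\<integral>\<^sup>+x. f (x + (c * (a \<bullet> x)) *\<^sub>R a) \<partial>lborel) = ennreal (1 / (1 + c)) * (\<integral>\<^sup>+x. f x \<partial>lborel)"
proof -
  define T where "T = (\<lambda>d x. x + (d * (a \<bullet> x)) *\<^sub>R a)"
  have lin: "linear (T d)" for d
    by (auto simp: T_def intro!: linearI simp: algebra_simps)
  have [measurable]: "T d \<in> borel_measurable borel" for d
    by (intro borel_measurable_continuous_onI linear_continuous_on linear_conv_bounded_linear[THEN iffD1] lin)
  have aa: "a \<bullet> a = 1" using assms(1) by (simp add: norm_eq_1)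
  \<comment> \<open>Two such maps compose with parameter \<open>p + q + p * q\<close>; this
    \<open>d\<close> solves \<open>c + d + c * d = 0\<close>, so \<open>T d\<close> is the inverse
    of \<open>T c\<close>.\<close>
  define d where "d = - c / (1 + c)"
  have comp: "T p (T q x) = x + ((p + q + p * q) * (a \<bullet> x)) *\<^sub>R a" for p q x
    by (auto simp: T_def inner_add_right aa algebra_simps)
  have "d + c + d * c = 0" "c + d + c * d = 0" using assms(2) by (simp_all add: d_def field_simps)
  then have inv: "T c (T d x) = x" "T d (T c x) = x" for x
    unfolding comp by simp_all
  have vim: "T c -` S = T d ` S" for S
    using inv by (intro equalityI subsetI) (force simp: image_iff intro: bexI[of _ "T c _"])+
  have det: "det (matrix (T d)) = 1 / (1 + c)"
    unfolding T_def using assms(2) by (subst det_rank_one_perturbation[OF assms(1)]) (simp add: d_def field_simps)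
  \<comment> \<open>It suffices to compare the two measures on boxes. The preimage of a box under
    \<open>T c\<close> is its image under \<open>T d\<close>, whose volume is smaller by the factor
    \<open>1 + c\<close> that the density restores.\<close>
  have "lborel = density (distr lborel borel (T c)) (\<lambda>_. ennreal (1 + c))"
  proof (rule lborel_eqI)
    fix l u :: "real^'m::_"
    assume le: "\<And>b. b \<in> Basis \<Longrightarrow> l \<bullet> b \<le> u \<bullet> b"
    have [measurable]: "T d ` box l u \<in> sets borel"
      unfolding vim[symmetric] using measurable_sets_borel[of "T c" borel "box l u"] by simp
    have m: "T d ` box l u \<in> lmeasurable"
      by (intro measurable_linear_image lin) simp
    have "emeasure lborel (T d ` box l u) = emeasure lebesgue (T d ` box l u)"
      by simp
    also have "\<dots> = ennreal (measure lebesgue (T d ` box l u))"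
      using m by (simp add: emeasure_eq_measure2)
    also have "\<dots> = ennreal (1 / (1 + c) * (\<Prod>b\<in>Basis. (u - l) \<bullet> b))"
      using assms(2) le by (subst measure_linear_image[OF lin]) (simp_all add: det measure_lborel_box_eq)
    finally have *: "emeasure lborel (T d ` box l u) = ennreal (1 / (1 + c) * (\<Prod>b\<in>Basis. (u - l) \<bullet> b))" .
    have "emeasure (density (distr lborel borel (T c)) (\<lambda>_. ennreal (1 + c))) (box l u)
       = ennreal (1 + c) * emeasure lborel (T d ` box l u)"
      by (simp add: emeasure_density nn_integral_cmult_indicator emeasure_distr vim)
    also have "\<dots> = ennreal (\<Prod>b\<in>Basis. (u - l) \<bullet> b)"
      unfolding * using assms(2) by (subst ennreal_mult'[symmetric]) simp_all
    finally show "emeasure (density (distr lborel borel (T c)) (\<lambda>_. ennreal (1 + c))) (box l u) = (\<Prod>b\<in>Basis. (u - l) \<bullet> b)" .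
  qed simp
  then have "(\<integral>\<^sup>+x. f x \<partial>lborel) = (\<integral>\<^sup>+x. f x \<partial>(density (distr lborel borel (T c)) (\<lambda>_. ennreal (1 + c))))"
    by (rule arg_cong)
  also have "\<dots> = ennreal (1 + c) * (\<integral>\<^sup>+x. f (T c x) \<partial>lborel)"
    by (simp add: nn_integral_density nn_integral_distr nn_integral_cmult)
  finally have "ennreal (1 / (1 + c)) * (\<integral>\<^sup>+x. f x \<partial>lborel) = (ennreal (1 / (1 + c)) * ennreal (1 + c)) * (\<integral>\<^sup>+x. f (T c x) \<partial>lborel)"
    by (simp add: mult.assoc)
  also have "ennreal (1 / (1 + c)) * ennreal (1 + c) = 1"
    using assms(2) by (subst ennreal_mult'[symmetric]) auto
  finally show ?thesis by (simp add: T_def)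
qed

text \<open>Together with positivity below, this allows the Gaussian normalising constant to be
  cancelled from an inequality without being computed.\<close>

lemma nn_integral_gauss_finite:
  "(\<integral>\<^sup>+x. ennreal (exp (- (norm x)\<^sup>2 / 2)) \<partial>(lborel :: 'a::euclidean_space measure)) < \<infinity>"
proof -
  have fin: "(\<integral>\<^sup>+t. ennreal (exp (- t\<^sup>2 / 2)) \<partial>(lborel :: real measure)) < \<infinity>"
  proof -
    have "integrable lborel (\<lambda>t::real. sqrt (2 * pi) * std_normal_density t)" by (intro integrable_mult_right) simp
    then have "integrable lborel (\<lambda>t::real. exp (- t\<^sup>2 / 2))"
      by (simp add: std_normal_density_def)
    then show ?thesis by (simp add: integrable_iff_bounded)
  qed
  have "ennreal (exp (- (norm x)\<^sup>2 / 2)) = (\<Prod>b\<in>Basis. ennreal (exp (- (x \<bullet> b)\<^sup>2 / 2)))" for x :: 'a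
  proof -
    have "(norm x)\<^sup>2 = (\<Sum>b\<in>Basis. (x \<bullet> b)\<^sup>2)"
      unfolding power2_norm_eq_inner by (subst euclidean_inner) (simp add: power2_eq_square)
    then show ?thesis
      by (subst prod_ennreal) (simp_all add: exp_sum[symmetric] sum_negf sum_divide_distrib)
  qed
  then have "(\<integral>\<^sup>+x. ennreal (exp (- (norm x)\<^sup>2 / 2)) \<partial>(lborel :: 'a measure))
      = (\<integral>\<^sup>+x. (\<Prod>b\<in>Basis. ennreal (exp (- (x \<bullet> b)\<^sup>2 / 2))) \<partial>(lborel :: 'a measure))"
    by (rule nn_integral_cong)
  also have "\<dots> = (\<Prod>b\<in>(Basis::'a set). \<integral>\<^sup>+t. ennreal (exp (- t\<^sup>2 / 2)) \<partial>lborel)"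
    by (rule nn_integral_lborel_prod) simp_all
  also have "\<dots> < \<infinity>" using fin by (simp only: prod_constant infinity_ennreal_def power_less_top_ennreal) simp
  finally show ?thesis .
qed

lemma nn_integral_gauss_pos:
  "(\<integral>\<^sup>+x. ennreal (exp (- (norm x)\<^sup>2 / 2)) \<partial>(lborel :: 'a::euclidean_space measure)) > 0"
proof (rule ccontr)
  assume "\<not> ?thesis"
  then have "AE x in (lborel :: 'a measure). ennreal (exp (- (norm x)\<^sup>2 / 2)) = 0"
    by (subst nn_integral_0_iff_AE[symmetric]) auto
  then have "AE x in (lborel :: 'a measure). False"
    by eventually_elim simp
  then show False
    using AE_iff_measurable[of UNIV "lborel :: 'a measure" "\<lambda>_. False"] by simp
qed

lemma norm_rank_one_perturbation:
  fixes a x :: "'a::real_inner"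
  assumes "norm a = 1"
  shows "(norm (x + (c * (a \<bullet> x)) *\<^sub>R a))\<^sup>2 = (norm x)\<^sup>2 + ((1 + c)\<^sup>2 - 1) * (a \<bullet> x)\<^sup>2"
proof -
  have "a \<bullet> a = 1" using assms by (simp add: norm_eq_1)
  then show ?thesis
    unfolding power2_norm_eq_inner
    by (simp add: inner_add_left inner_add_right inner_commute[of x a]
        power2_eq_square algebra_simps)
qed

text \<open>Replacing \<open>b\<close> by a unit vector \<open>u\<close> in its direction only
  enlarges the integrand, and scaling along \<open>u\<close> then turns the exponent into a pure
  Gaussian one. The bound \<open>s < 1/2\<close> keeps the exponent negative definite.\<close>

lemma nn_integral_gauss_expand_direction:
  fixes b :: "real^'m::{finite,wellorder}"
  assumes "norm b \<le> 1" "0 \<le> s" "s < 1/2"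
  shows "(\<integral>\<^sup>+x. ennreal (exp (- (norm x)\<^sup>2 / 2 + s * (b \<bullet> x)\<^sup>2)) \<partial>lborel)
     \<le> ennreal (1 / sqrt (1 - 2 * s)) * (\<integral>\<^sup>+x. ennreal (exp (- (norm x)\<^sup>2 / 2)) \<partial>(lborel :: (real^'m::_) measure))"
proof -
  obtain u :: "real^'m::_" where u: "norm u = 1" and le: "\<And>x. (b \<bullet> x)\<^sup>2 \<le> (u \<bullet> x)\<^sup>2"
  proof (cases "b = 0")
    case True
    obtain u :: "real^'m::_" where "norm u = 1" using vector_choose_size[of 1] by auto
    then show ?thesis using that True by simp
  next
    case False
    have "(b \<bullet> x)\<^sup>2 \<le> (sgn b \<bullet> x)\<^sup>2" for x
    proof -
      have "(b \<bullet> x)\<^sup>2 = (norm b)\<^sup>2 * (sgn b \<bullet> x)\<^sup>2"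
        using False by (simp add: sgn_div_norm power_mult_distrib field_simps)
      also have "\<dots> \<le> 1 * (sgn b \<bullet> x)\<^sup>2"
        using assms(1) by (intro mult_right_mono) (auto simp: power_le_one)
      finally show ?thesis by simp
    qed
    then show ?thesis using that[of "sgn b"] False by (simp add: norm_sgn)
  qed
  \<comment> \<open>Chosen so that half the squared norm after the substitution is
    \<open>(norm x)\<^sup>2 / 2 - s * (u \<bullet> x)\<^sup>2\<close>.\<close>
  define c where "c = sqrt (1 - 2 * s) - 1"
  have c: "c > -1" "(1 + c)\<^sup>2 - 1 = - 2 * s" using assms by (auto simp: c_def)
  let ?f = "\<lambda>x::real^'m::_. ennreal (exp (- (norm x)\<^sup>2 / 2))"
  have "(\<integral>\<^sup>+x. ennreal (exp (- (norm x)\<^sup>2 / 2 + s * (b \<bullet> x)\<^sup>2)) \<partial>lborel)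
      \<le> (\<integral>\<^sup>+x. ?f (x + (c * (u \<bullet> x)) *\<^sub>R u) \<partial>lborel)"
  proof (intro nn_integral_mono ennreal_leI)
    fix x
    have "s * (b \<bullet> x)\<^sup>2 \<le> s * (u \<bullet> x)\<^sup>2" using le assms(2) by (rule mult_left_mono)
    then show "exp (- (norm x)\<^sup>2 / 2 + s * (b \<bullet> x)\<^sup>2) \<le> exp (- (norm (x + (c * (u \<bullet> x)) *\<^sub>R u))\<^sup>2 / 2)"
      unfolding norm_rank_one_perturbation[OF u] c(2) by simp
  qed
  also have "\<dots> = ennreal (1 / (1 + c)) * (\<integral>\<^sup>+x. ?f x \<partial>lborel)"
    by (rule nn_integral_rank_one_substitution[OF u c(1)]) simp
  finally show ?thesis by (simp add: c_def)
qed

text \<open>Induction on \<open>A\<close>: a substitution along \<open>a\<close> absorbs the term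
  \<open>t * (a \<bullet> x)\<^sup>2\<close> at the price of a factor
  \<open>1 / sqrt (1 + 2 * t)\<close>, leaves the orthogonal directions in \<open>A\<close> alone,
  and shortens \<open>b\<close> or keeps its length. The hypothesis \<open>norm b \<le> 1\<close>,
  rather than equality, is what survives this step.\<close>

lemma nn_integral_gauss_quadratic:
  fixes b :: "real^'m::{finite,wellorder}"
  assumes "finite A" "pairwise orthogonal A" "\<And>a. a \<in> A \<Longrightarrow> norm a = 1"
    and "norm b \<le> 1" "0 \<le> s" "s < 1/2" "0 \<le> t"
  shows "(\<integral>\<^sup>+x. ennreal (exp (- (norm x)\<^sup>2 / 2 + s * (b \<bullet> x)\<^sup>2 - t * (\<Sum>a\<in>A. (a \<bullet> x)\<^sup>2))) \<partial>lborel)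
     \<le> ennreal (1 / (sqrt (1 + 2 * t) ^ card A * sqrt (1 - 2 * s)))
        * (\<integral>\<^sup>+x. ennreal (exp (- (norm x)\<^sup>2 / 2)) \<partial>(lborel :: (real^'m::_) measure))"
  using assms
proof (induction A arbitrary: b rule: finite_induct)
  case empty
  then show ?case using nn_integral_gauss_expand_direction[of b s] by simp
next
  case (insert a A)
  have a: "norm a = 1" "a \<bullet> a = 1" using insert.prems(2) by (auto simp: norm_eq_1[symmetric])
  have orth: "a' \<bullet> a = 0" if "a' \<in> A" for a'
    using that insert.prems(1) insert.hyps by (auto simp: pairwise_insert orthogonal_def)
  define c where "c = sqrt (1 + 2 * t) - 1"
  define d where "d = - c / (1 + c)"
  have c: "c \<ge> 0" "(1 + c)\<^sup>2 - 1 = 2 * t" using insert.prems by (auto simp: c_def)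
  have d: "1 + d = 1 / (1 + c)" "d + c + d * c = 0" using c(1) by (auto simp: d_def field_simps)
  \<comment> \<open>The map with parameter \<open>d\<close> is self-adjoint and inverse to the
    substitution, so \<open>b'\<close> pairs with the new variable as \<open>b\<close> does with the
    old one. Since \<open>0 < 1 + d \<le> 1\<close>, the component of \<open>b\<close> along
    \<open>a\<close> can only shrink.\<close>
  define b' where "b' = b + (d * (a \<bullet> b)) *\<^sub>R a"
  have b'x: "b' \<bullet> (x + (c * (a \<bullet> x)) *\<^sub>R a) = b \<bullet> x" for x
  proof -
    have "b' \<bullet> (x + (c * (a \<bullet> x)) *\<^sub>R a) = b \<bullet> x + (d + c + d * c) * ((a \<bullet> b) * (a \<bullet> x))"
      unfolding b'_def by (simp add: inner_add_left inner_add_right a inner_commute[of b a] algebra_simps)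
    then show ?thesis using d(2) by simp
  qed
  have "norm b' \<le> 1"
  proof -
    have "(1 + d)\<^sup>2 \<le> 1" unfolding d(1) using c(1) by (intro power_le_one) auto
    then have "((1 + d)\<^sup>2 - 1) * (a \<bullet> b)\<^sup>2 \<le> 0" by (intro mult_nonpos_nonneg) auto
    then have "(norm b')\<^sup>2 \<le> (norm b)\<^sup>2" unfolding b'_def norm_rank_one_perturbation[OF a(1)] by simp
    then show ?thesis using insert.prems(3) by (meson norm_ge_zero order_trans power2_le_imp_le)
  qed
  let ?g = "\<lambda>y::real^'m::_. ennreal (exp (- (norm y)\<^sup>2 / 2 + s * (b' \<bullet> y)\<^sup>2 - t * (\<Sum>a\<in>A. (a \<bullet> y)\<^sup>2)))"
  let ?Z = "\<integral>\<^sup>+x. ennreal (exp (- (norm x)\<^sup>2 / 2)) \<partial>(lborel :: (real^'m::_) measure)"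
  have "(\<integral>\<^sup>+x. ennreal (exp (- (norm x)\<^sup>2 / 2 + s * (b \<bullet> x)\<^sup>2 - t * (\<Sum>a\<in>insert a A. (a \<bullet> x)\<^sup>2))) \<partial>lborel)
     = (\<integral>\<^sup>+x. ?g (x + (c * (a \<bullet> x)) *\<^sub>R a) \<partial>lborel)"
  proof (intro nn_integral_cong arg_cong[where f=ennreal] arg_cong[where f=exp])
    fix x
    have "(\<Sum>a'\<in>A. (a' \<bullet> (x + (c * (a \<bullet> x)) *\<^sub>R a))\<^sup>2) = (\<Sum>a\<in>A. (a \<bullet> x)\<^sup>2)"
      by (intro sum.cong refl) (simp add: inner_add_right orth)
    then show "- (norm x)\<^sup>2 / 2 + s * (b \<bullet> x)\<^sup>2 - t * (\<Sum>a\<in>insert a A. (a \<bullet> x)\<^sup>2) =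
      - (norm (x + (c * (a \<bullet> x)) *\<^sub>R a))\<^sup>2 / 2 + s * (b' \<bullet> (x + (c * (a \<bullet> x)) *\<^sub>R a))\<^sup>2
        - t * (\<Sum>a'\<in>A. (a' \<bullet> (x + (c * (a \<bullet> x)) *\<^sub>R a))\<^sup>2)"
      unfolding b'x norm_rank_one_perturbation[OF a(1)] c(2)
      using insert.hyps by (simp add: field_simps)
  qed
  also have "\<dots> = ennreal (1 / (1 + c)) * (\<integral>\<^sup>+x. ?g x \<partial>lborel)"
    using c(1) by (intro nn_integral_rank_one_substitution[OF a(1)]) simp_all
  also have "\<dots> \<le> ennreal (1 / (1 + c)) * (ennreal (1 / (sqrt (1 + 2 * t) ^ card A * sqrt (1 - 2 * s))) * ?Z)"
    using insert.prems \<open>norm b' \<le> 1\<close> by (intro mult_left_mono insert.IH) (auto simp: pairwise_insert)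
  also have "\<dots> = ennreal (1 / (sqrt (1 + 2 * t) ^ card (insert a A) * sqrt (1 - 2 * s))) * ?Z"
    using insert.hyps insert.prems c(1)
    by (subst mult.assoc[symmetric], subst ennreal_mult[symmetric]) (auto simp: c_def mult.assoc)
  finally show ?case .
qed

section \<open>The averaging argument\<close>

lemma sum_product_weights_affine:
  fixes p \<alpha> :: "'k \<Rightarrow> real" and q \<beta> :: "'l \<Rightarrow> real"
  assumes "(\<Sum>k\<in>K. p k) = 1" "(\<Sum>l\<in>L. q l) = 1"
  shows "(\<Sum>k\<in>K. \<Sum>l\<in>L. p k * q l * (c + s * \<beta> l - t * \<alpha> k))
    = c + s * (\<Sum>l\<in>L. q l * \<beta> l) - t * (\<Sum>k\<in>K. p k * \<alpha> k)"
proof -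
  have "(\<Sum>l\<in>L. p k * q l * (c + s * \<beta> l - t * \<alpha> k)) = p k * (c + s * (\<Sum>l\<in>L. q l * \<beta> l)) - t * (p k * \<alpha> k)" for k
  proof -
    have "(\<Sum>l\<in>L. p k * q l * (c + s * \<beta> l - t * \<alpha> k)) = (\<Sum>l\<in>L. p k * (c - t * \<alpha> k) * q l + p k * s * (q l * \<beta> l))"
      by (intro sum.cong refl) (simp add: algebra_simps)
    also have "\<dots> = p k * (c - t * \<alpha> k) * (\<Sum>l\<in>L. q l) + p k * s * (\<Sum>l\<in>L. q l * \<beta> l)"
      by (simp only: sum.distrib sum_distrib_left)
    finally show ?thesis using assms(2) by (simp add: algebra_simps)
  qed
  then have "(\<Sum>k\<in>K. \<Sum>l\<in>L. p k * q l * (c + s * \<beta> l - t * \<alpha> k))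
     = (\<Sum>k\<in>K. p k) * (c + s * (\<Sum>l\<in>L. q l * \<beta> l)) - t * (\<Sum>k\<in>K. p k * \<alpha> k)"
    by (simp only: sum_subtractf sum_distrib_left sum_distrib_right)
  then show ?thesis using assms(1) by simp
qed

text \<open>The weights \<open>p i\<close> describe a convex combination of rank-\<open>d\<close>
  projections, and \<open>b\<close> a quadratic form of trace one. If every \<open>x\<close> failed
  for some \<open>i\<close>, the Gaussian mass would be at most
  \<open>2 * card I / sqrt (1 + 2 * t) ^ d\<close> times itself, which the last hypothesis
  excludes.\<close>

lemma gauss_averaging_wellorder:
  fixes A :: "'i \<Rightarrow> 'k \<Rightarrow> (real^'m::{finite,wellorder}) set" and b :: "'l \<Rightarrow> real^'m::_"
  assumes "finite I" "finite L" and K: "\<And>i. i \<in> I \<Longrightarrow> finite (K i)"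
    and p: "\<And>i k. i \<in> I \<Longrightarrow> k \<in> K i \<Longrightarrow> 0 \<le> p i k" "\<And>i. i \<in> I \<Longrightarrow> (\<Sum>k\<in>K i. p i k) = 1"
    and A: "\<And>i k. i \<in> I \<Longrightarrow> k \<in> K i \<Longrightarrow>
      finite (A i k) \<and> pairwise orthogonal (A i k) \<and> (\<forall>a\<in>A i k. norm a = 1) \<and> card (A i k) = d"
    and b: "(\<Sum>l\<in>L. (norm (b l))\<^sup>2) = 1"
    and t: "0 \<le> t" "2 * real (card I) < sqrt (1 + 2 * t) ^ d"
  shows "\<exists>x. \<forall>i\<in>I. 3/8 * (\<Sum>l\<in>L. (b l \<bullet> x)\<^sup>2) < t * (\<Sum>k\<in>K i. p i k * (\<Sum>a\<in>A i k. (a \<bullet> x)\<^sup>2))"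
proof (rule ccontr)
  assume "\<not> ?thesis"
  then have neg: "\<exists>i\<in>I. t * (\<Sum>k\<in>K i. p i k * (\<Sum>a\<in>A i k. (a \<bullet> x)\<^sup>2)) \<le> 3/8 * (\<Sum>l\<in>L. (b l \<bullet> x)\<^sup>2)" for x
    by (meson linorder_not_less)
  \<comment> \<open>Splitting \<open>b l\<close> into the weight \<open>q l\<close> and the
    direction \<open>sgn (b l)\<close> makes the form a convex combination. A zero
    \<open>b l\<close> gets weight zero, and its direction \<open>0\<close> still has norm at most
    one.\<close>
  define q where "q l = (norm (b l))\<^sup>2" for l
  define h where "h i k l x = exp (- (norm x)\<^sup>2 / 2 + 3/8 * (sgn (b l) \<bullet> x)\<^sup>2 - t * (\<Sum>a\<in>A i k. (a \<bullet> x)\<^sup>2))" for i k l x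
  have h: "h i k l x \<ge> 0" for i k l x by (simp add: h_def)
  have [measurable]: "h i k l \<in> borel_measurable borel" for i k l unfolding h_def by measurable
  have q: "q l \<ge> 0" "(\<Sum>l\<in>L. q l) = 1" for l using b by (auto simp: q_def)
  have bq: "(b l \<bullet> x)\<^sup>2 = q l * (sgn (b l) \<bullet> x)\<^sup>2" for l x
    by (cases "b l = 0") (simp_all add: q_def sgn_div_norm power_mult_distrib field_simps)
  have pq: "(\<Sum>(k,l)\<in>K i \<times> L. p i k * q l) = 1" if "i \<in> I" for i
    using p(2)[OF that] q(2) by (simp add: sum.cartesian_product[symmetric] sum_product[symmetric])
  \<comment> \<open>Jensen's inequality for \<open>exp\<close> reduces both quadratic forms to single summands.\<close>
  have jensen: "exp (- (norm x)\<^sup>2 / 2 + 3/8 * (\<Sum>l\<in>L. (b l \<bullet> x)\<^sup>2) - t * (\<Sum>k\<in>K i. p i k * (\<Sum>a\<in>A i k. (a \<bullet> x)\<^sup>2)))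
      \<le> (\<Sum>(k,l)\<in>K i \<times> L. p i k * q l * h i k l x)" if i: "i \<in> I" for i x
  proof -
    define y where "y kl = - (norm x)\<^sup>2 / 2 + 3/8 * (sgn (b (snd kl)) \<bullet> x)\<^sup>2 - t * (\<Sum>a\<in>A i (fst kl). (a \<bullet> x)\<^sup>2)" for kl
    define r where "r kl = p i (fst kl) * q (snd kl)" for kl
    have "exp (\<Sum>kl\<in>K i \<times> L. r kl *\<^sub>R y kl) \<le> (\<Sum>kl\<in>K i \<times> L. r kl * exp (y kl))"
    proof (intro convex_on_sum[where C=UNIV])
      show "convex_on UNIV (exp :: real \<Rightarrow> real)" by (rule exp_convex)
      show "K i \<times> L \<noteq> {}" using pq[OF i] by (intro notI) simp
      show "sum r (K i \<times> L) = 1" using pq[OF i] by (simp add: r_def case_prod_unfold)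
    qed (use p(1)[OF i] q K[OF i] \<open>finite L\<close> in \<open>auto simp: r_def\<close>)
    also have "(\<Sum>kl\<in>K i \<times> L. r kl *\<^sub>R y kl) = (\<Sum>k\<in>K i. \<Sum>l\<in>L. p i k * q l * (- (norm x)\<^sup>2 / 2 + 3/8 * (sgn (b l) \<bullet> x)\<^sup>2 - t * (\<Sum>a\<in>A i k. (a \<bullet> x)\<^sup>2)))"
      by (simp add: sum.cartesian_product r_def y_def case_prod_unfold)
    also have "\<dots> = - (norm x)\<^sup>2 / 2 + 3/8 * (\<Sum>l\<in>L. (b l \<bullet> x)\<^sup>2) - t * (\<Sum>k\<in>K i. p i k * (\<Sum>a\<in>A i k. (a \<bullet> x)\<^sup>2))"
      unfolding bq by (rule sum_product_weights_affine) (use p(2)[OF i] q(2) in auto)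
    finally show ?thesis by (simp add: r_def y_def h_def case_prod_unfold)
  qed
  let ?g = "\<lambda>x::real^'m::_. exp (- (norm x)\<^sup>2 / 2)"
  define Z where "Z = (\<integral>\<^sup>+x. ennreal (?g x) \<partial>lborel)"
  define D where "D = sqrt (1 + 2 * t) ^ d"
  have D: "D > 0" unfolding D_def using t by simp
  have hint: "(\<integral>\<^sup>+x. ennreal (h i k l x) \<partial>lborel) \<le> ennreal (2 / D) * Z" if "i \<in> I" "k \<in> K i" for i k l
  proof -
    \<comment> \<open>The value \<open>s = 3/8\<close> makes this root rational; its reciprocal is
      the factor \<open>2\<close> in the hypothesis on \<open>t\<close>.\<close>
    have "sqrt (1 - 2 * (3/8)) = sqrt ((1/2)\<^sup>2)" by (simp add: power2_eq_square)
    also have "\<dots> = 1/2" by (rule real_sqrt_abs[THEN trans]) simp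
    finally have half: "sqrt (1 - 2 * (3/8)) = 1/2" .
    have "norm (sgn (b l)) \<le> 1" by (simp add: norm_sgn)
    then show ?thesis
      using nn_integral_gauss_quadratic[of "A i k" "sgn (b l)" "3/8" t] A[OF that] t(1)
      unfolding half by (simp add: h_def Z_def D_def)
  qed
  \<comment> \<open>An index failing at \<open>x\<close> has a nonnegative difference of quadratic
    forms in its exponent, so its term alone dominates the Gaussian; all other terms are
    nonnegative.\<close>
  have "?g x \<le> (\<Sum>i\<in>I. \<Sum>(k,l)\<in>K i \<times> L. p i k * q l * h i k l x)" for x
  proof -
    obtain i where i: "i \<in> I" "t * (\<Sum>k\<in>K i. p i k * (\<Sum>a\<in>A i k. (a \<bullet> x)\<^sup>2)) \<le> 3/8 * (\<Sum>l\<in>L. (b l \<bullet> x)\<^sup>2)"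
      using neg by blast
    then have "?g x \<le> exp (- (norm x)\<^sup>2 / 2 + 3/8 * (\<Sum>l\<in>L. (b l \<bullet> x)\<^sup>2) - t * (\<Sum>k\<in>K i. p i k * (\<Sum>a\<in>A i k. (a \<bullet> x)\<^sup>2)))"
      by simp
    also note jensen[OF i(1)]
    also have "(\<Sum>(k,l)\<in>K i \<times> L. p i k * q l * h i k l x) \<le> (\<Sum>i\<in>I. \<Sum>(k,l)\<in>K i \<times> L. p i k * q l * h i k l x)"
      using i(1) \<open>finite I\<close> p(1) q(1) h by (intro member_le_sum sum_nonneg) auto
    finally show ?thesis .
  qed
  then have "Z \<le> (\<integral>\<^sup>+x. ennreal (\<Sum>i\<in>I. \<Sum>(k,l)\<in>K i \<times> L. p i k * q l * h i k l x) \<partial>lborel)"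
    unfolding Z_def by (intro nn_integral_mono ennreal_leI)
  also have "\<dots> = (\<integral>\<^sup>+x. (\<Sum>i\<in>I. \<Sum>(k,l)\<in>K i \<times> L. ennreal (p i k * q l) * ennreal (h i k l x)) \<partial>lborel)"
  proof (intro nn_integral_cong)
    fix x
    have "ennreal (\<Sum>i\<in>I. \<Sum>(k,l)\<in>K i \<times> L. p i k * q l * h i k l x)
        = (\<Sum>i\<in>I. ennreal (\<Sum>(k,l)\<in>K i \<times> L. p i k * q l * h i k l x))"
      using p(1) q(1) h by (intro sum_ennreal[symmetric] sum_nonneg) auto
    also have "\<dots> = (\<Sum>i\<in>I. \<Sum>kl\<in>K i \<times> L. ennreal (p i (fst kl) * q (snd kl) * h i (fst kl) (snd kl) x))"
      unfolding case_prod_unfold using p(1) q(1) h by (intro sum.cong refl sum_ennreal[symmetric]) auto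
    also have "\<dots> = (\<Sum>i\<in>I. \<Sum>kl\<in>K i \<times> L. ennreal (p i (fst kl) * q (snd kl)) * ennreal (h i (fst kl) (snd kl) x))"
      using p(1) q(1) h by (intro sum.cong refl ennreal_mult) auto
    finally show "ennreal (\<Sum>i\<in>I. \<Sum>(k,l)\<in>K i \<times> L. p i k * q l * h i k l x)
        = (\<Sum>i\<in>I. \<Sum>(k,l)\<in>K i \<times> L. ennreal (p i k * q l) * ennreal (h i k l x))"
      by (simp add: case_prod_unfold)
  qed
  also have "\<dots> = (\<Sum>i\<in>I. \<Sum>(k,l)\<in>K i \<times> L. ennreal (p i k * q l) * (\<integral>\<^sup>+x. ennreal (h i k l x) \<partial>lborel))"
    unfolding case_prod_unfold by (simp add: nn_integral_sum nn_integral_cmult)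
  also have "\<dots> \<le> (\<Sum>i\<in>I. \<Sum>(k,l)\<in>K i \<times> L. ennreal (p i k * q l) * (ennreal (2 / D) * Z))"
    by (intro sum_mono) (auto intro!: mult_left_mono hint)
  also have "\<dots> = (\<Sum>i\<in>I. ennreal (2 / D) * Z)"
  proof (intro sum.cong refl)
    fix i assume i: "i \<in> I"
    have "(\<Sum>kl\<in>K i \<times> L. ennreal (p i (fst kl) * q (snd kl))) = ennreal (\<Sum>kl\<in>K i \<times> L. p i (fst kl) * q (snd kl))"
      using p(1)[OF i] q(1) by (intro sum_ennreal) auto
    also have "\<dots> = 1" using pq[OF i] by (simp add: case_prod_unfold)
    finally show "(\<Sum>(k,l)\<in>K i \<times> L. ennreal (p i k * q l) * (ennreal (2 / D) * Z)) = ennreal (2 / D) * Z"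
      by (simp add: case_prod_unfold sum_distrib_right[symmetric])
  qed
  also have "\<dots> = ennreal (real (card I) * (2 / D)) * Z"
    using D by (subst ennreal_mult) (simp_all add: ennreal_of_nat_eq_real_of_nat mult.assoc)
  finally have le: "Z \<le> ennreal (real (card I) * (2 / D)) * Z" .
  have "Z < \<infinity>" "0 < Z"
    unfolding Z_def by (rule nn_integral_gauss_finite nn_integral_gauss_pos)+
  then obtain z where z: "Z = ennreal z" "z > 0"
    by (cases Z) auto
  have "z \<le> real (card I) * (2 / D) * z"
    using le z D by (simp add: ennreal_mult[symmetric] del: times_divide_eq_right)
  then have "D \<le> 2 * real (card I)"
    using z(2) D by (simp add: field_simps)
  then show False using t(2) by (simp add: D_def)
qed

text \<open>The library states the change of variables for linear maps only over index types that are
  well-ordered; this type supplies such an index for an arbitrary Euclidean space.\<close>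

typedef (overloaded) 'a dim_index = "{..<DIM('a::euclidean_space)}"
  by (metis DIM_positive lessThan_iff)

instantiation dim_index :: (euclidean_space) linorder
begin
definition "x \<le> y \<longleftrightarrow> Rep_dim_index x \<le> Rep_dim_index y"
definition "x < y \<longleftrightarrow> Rep_dim_index x < Rep_dim_index y"
instance
  by standard (auto simp: less_eq_dim_index_def less_dim_index_def Rep_dim_index_inject)
end

instance dim_index :: (euclidean_space) wellorder
proof
  fix P :: "'a dim_index \<Rightarrow> bool" and x
  assume step: "\<And>x. (\<And>y. y < x \<Longrightarrow> P y) \<Longrightarrow> P x"
  show "P x"
    by (induction x rule: measure_induct_rule[of Rep_dim_index]) (rule step, simp only: less_dim_index_def)
qed

lemma card_dim_index: "card (UNIV :: 'a::euclidean_space dim_index set) = DIM('a)"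
  using type_definition.card[OF type_definition_dim_index[where 'a='a]] by simp

instance dim_index :: (euclidean_space) finite
proof
  show "finite (UNIV :: 'a dim_index set)"
    unfolding type_definition.univ[OF type_definition_dim_index[where 'a='a]] by simp
qed

text \<open>Orthonormal systems, norms and inner products are carried by a linear isometry onto
  \<open>real^'a dim_index\<close>, where the well-ordered version applies.\<close>

lemma gauss_averaging:
  fixes A :: "'i \<Rightarrow> 'k \<Rightarrow> 'a::euclidean_space set" and b :: "'l \<Rightarrow> 'a"
  assumes "finite I" "finite L" "\<And>i. i \<in> I \<Longrightarrow> finite (K i)"
    and "\<And>i k. i \<in> I \<Longrightarrow> k \<in> K i \<Longrightarrow> 0 \<le> p i k" "\<And>i. i \<in> I \<Longrightarrow> (\<Sum>k\<in>K i. p i k) = 1"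
    and A: "\<And>i k. i \<in> I \<Longrightarrow> k \<in> K i \<Longrightarrow>
      finite (A i k) \<and> pairwise orthogonal (A i k) \<and> (\<forall>a\<in>A i k. norm a = 1) \<and> card (A i k) = d"
    and "(\<Sum>l\<in>L. (norm (b l))\<^sup>2) = 1"
    and "0 \<le> t" "2 * real (card I) < sqrt (1 + 2 * t) ^ d"
  shows "\<exists>x. \<forall>i\<in>I. 3/8 * (\<Sum>l\<in>L. (b l \<bullet> x)\<^sup>2) < t * (\<Sum>k\<in>K i. p i k * (\<Sum>a\<in>A i k. (a \<bullet> x)\<^sup>2))"
proof -
  have dim: "dim (UNIV :: 'a set) = dim (UNIV :: (real^'a dim_index) set)"
    by (simp add: card_dim_index)
  obtain f :: "'a \<Rightarrow> real^'a dim_index" and g where f: "linear f" "\<And>x. norm (f x) = norm x" "\<And>y. f (g y) = y"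
  proof (rule isometries_subspaces[OF subspace_UNIV subspace_UNIV dim])
    fix f :: "'a \<Rightarrow> real^'a dim_index" and g
    assume "linear f" "\<And>x. x \<in> UNIV \<Longrightarrow> norm (f x) = norm x" "\<And>y. y \<in> UNIV \<Longrightarrow> f (g y) = y"
    then show thesis using that[of f g] by simp
  qed
  have inner: "f x \<bullet> f y = x \<bullet> y" for x y
    unfolding dot_norm linear_add[OF f(1), symmetric] f(2) ..
  have inj: "inj_on f S" for S
  proof (rule inj_onI)
    fix x y assume "f x = f y"
    then have "norm (f (x - y)) = 0" by (simp add: linear_diff[OF f(1)])
    then show "x = y" by (simp add: f(2))
  qed
  have "\<exists>y. \<forall>i\<in>I. 3/8 * (\<Sum>l\<in>L. (f (b l) \<bullet> y)\<^sup>2) < t * (\<Sum>k\<in>K i. p i k * (\<Sum>a\<in>f ` A i k. (a \<bullet> y)\<^sup>2))"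
  proof (rule gauss_averaging_wellorder[where d=d])
    fix i k assume "i \<in> I" "k \<in> K i"
    then show "finite (f ` A i k) \<and> pairwise orthogonal (f ` A i k) \<and> (\<forall>a\<in>f ` A i k. norm a = 1) \<and> card (f ` A i k) = d"
      using A[of i k] by (simp add: pairwise_image pairwise_def orthogonal_def inner f(2) card_image[OF inj]) metis
  qed (use assms(1-5,7-9) in \<open>simp_all add: f(2)\<close>)
  then obtain y where y: "\<forall>i\<in>I. 3/8 * (\<Sum>l\<in>L. (f (b l) \<bullet> y)\<^sup>2) < t * (\<Sum>k\<in>K i. p i k * (\<Sum>a\<in>f ` A i k. (a \<bullet> y)\<^sup>2))"
    by blast
  \<comment> \<open>As \<open>g\<close> is a right inverse of the isometry, the vector found pulls
    back to \<open>g y\<close> with all pairings unchanged.\<close>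
  have "f a \<bullet> y = a \<bullet> g y" for a using inner[of a "g y"] f(3) by simp
  then show ?thesis
    using y by (intro exI[of _ "g y"]) (simp add: sum.reindex[OF inj])
qed

text \<open>The normalised statement is applied to unit directions with weights
  \<open>(n i k)\<^sup>2 / P i\<close> and to \<open>b l / sqrt \<tau>\<close>; clearing
  denominators turns \<open>3/8\<close> into the factor \<open>8/3\<close>.\<close>

lemma gauss_averaging_homogeneous:
  fixes a :: "'i \<Rightarrow> 'k \<Rightarrow> 'd \<Rightarrow> 'a::euclidean_space" and b :: "'l \<Rightarrow> 'a"
  assumes "finite I" "finite K" "finite D" "finite L"
    and norm: "\<And>i k e. i \<in> I \<Longrightarrow> k \<in> K \<Longrightarrow> e \<in> D \<Longrightarrow> norm (a i k e) = n i k"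
    and orth: "\<And>i k e e'. i \<in> I \<Longrightarrow> k \<in> K \<Longrightarrow> e \<in> D \<Longrightarrow> e' \<in> D \<Longrightarrow> e \<noteq> e' \<Longrightarrow> a i k e \<bullet> a i k e' = 0"
    and posn: "\<And>i. i \<in> I \<Longrightarrow> (\<Sum>k\<in>K. (n i k)\<^sup>2) > 0"
    and posb: "(\<Sum>l\<in>L. (norm (b l))\<^sup>2) > 0"
    and t: "0 \<le> t" "2 * real (card I) < sqrt (1 + 2 * t) ^ card D"
  shows "\<exists>x. \<forall>i\<in>I. (\<Sum>k\<in>K. (n i k)\<^sup>2) * (\<Sum>l\<in>L. (b l \<bullet> x)\<^sup>2)
    < 8/3 * t * (\<Sum>l\<in>L. (norm (b l))\<^sup>2) * (\<Sum>k\<in>K. \<Sum>e\<in>D. (a i k e \<bullet> x)\<^sup>2)"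
proof -
  define \<tau> where "\<tau> = (\<Sum>l\<in>L. (norm (b l))\<^sup>2)"
  define P where "P i = (\<Sum>k\<in>K. (n i k)\<^sup>2)" for i
  \<comment> \<open>Zero vectors have no direction; discarding them changes no sum, since their
    weights and pairings vanish.\<close>
  define K' where "K' i = {k \<in> K. n i k \<noteq> 0}" for i
  have sum_K': "(\<Sum>k\<in>K' i. f k) = (\<Sum>k\<in>K. f k)" if "\<And>k. k \<in> K \<Longrightarrow> n i k = 0 \<Longrightarrow> f k = 0" for f :: "'k \<Rightarrow> real" and i
    using that \<open>finite K\<close> by (intro sum.mono_neutral_left) (auto simp: K'_def)
  \<comment> \<open>Two of these vectors with the same direction would coincide, having equal norms,
    and by orthogonality would be zero. Hence the set of directions really has \<open>card D\<close>
    elements.\<close>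
  have inj: "inj_on (\<lambda>e. sgn (a i k e)) D" if "i \<in> I" "k \<in> K' i" for i k
  proof (rule inj_onI, rule ccontr)
    fix e e' assume e: "e \<in> D" "e' \<in> D" "sgn (a i k e) = sgn (a i k e')" "e \<noteq> e'"
    have "a i k e = a i k e'"
      using e that norm[of i k] by (simp add: sgn_div_norm K'_def)
    then have "a i k e = 0" using orth[of i k e e'] e that by (simp add: K'_def)
    then show False using norm[of i k e] e that by (simp add: K'_def)
  qed
  have "\<exists>x. \<forall>i\<in>I. 3/8 * (\<Sum>l\<in>L. ((b l /\<^sub>R sqrt \<tau>) \<bullet> x)\<^sup>2)
      < t * (\<Sum>k\<in>K' i. (n i k)\<^sup>2 / P i * (\<Sum>c\<in>(\<lambda>e. sgn (a i k e)) ` D. (c \<bullet> x)\<^sup>2))"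
  proof (rule gauss_averaging[where d="card D"])
    fix i assume i: "i \<in> I"
    show "(\<Sum>k\<in>K' i. (n i k)\<^sup>2 / P i) = 1"
      using posn[OF i] by (subst sum_K') (simp_all add: P_def sum_divide_distrib[symmetric])
    show "finite (K' i)" using \<open>finite K\<close> by (simp add: K'_def)
    fix k assume k: "k \<in> K' i"
    show "0 \<le> (n i k)\<^sup>2 / P i" using posn[OF i] by (simp add: P_def)
    have "norm (sgn (a i k e)) = 1" if "e \<in> D" for e
      using norm[of i k e] that i k by (auto simp: norm_sgn K'_def)
    moreover have "pairwise orthogonal ((\<lambda>e. sgn (a i k e)) ` D)"
      using orth i k by (auto simp: pairwise_def orthogonal_def sgn_div_norm K'_def)
    ultimately show "finite ((\<lambda>e. sgn (a i k e)) ` D) \<and> pairwise orthogonal ((\<lambda>e. sgn (a i k e)) ` D)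
        \<and> (\<forall>c\<in>(\<lambda>e. sgn (a i k e)) ` D. norm c = 1) \<and> card ((\<lambda>e. sgn (a i k e)) ` D) = card D"
      using \<open>finite D\<close> inj[OF i k] by (simp add: card_image)
  next
    show "(\<Sum>l\<in>L. (norm (b l /\<^sub>R sqrt \<tau>))\<^sup>2) = 1"
      using posb by (simp add: power_mult_distrib sum_distrib_left[symmetric] \<tau>_def[symmetric] power_inverse)
  qed (use assms in simp_all)
  then obtain x where x: "\<And>i. i \<in> I \<Longrightarrow> 3/8 * (\<Sum>l\<in>L. ((b l /\<^sub>R sqrt \<tau>) \<bullet> x)\<^sup>2)
      < t * (\<Sum>k\<in>K' i. (n i k)\<^sup>2 / P i * (\<Sum>c\<in>(\<lambda>e. sgn (a i k e)) ` D. (c \<bullet> x)\<^sup>2))"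
    by blast
  have "P i * (\<Sum>l\<in>L. (b l \<bullet> x)\<^sup>2) < 8/3 * t * \<tau> * (\<Sum>k\<in>K. \<Sum>e\<in>D. (a i k e \<bullet> x)\<^sup>2)" if i: "i \<in> I" for i
  proof -
    have "(\<Sum>k\<in>K' i. (n i k)\<^sup>2 / P i * (\<Sum>c\<in>(\<lambda>e. sgn (a i k e)) ` D. (c \<bullet> x)\<^sup>2))
        = (\<Sum>k\<in>K' i. \<Sum>e\<in>D. (a i k e \<bullet> x)\<^sup>2 / P i)"
    proof (intro sum.cong refl)
      fix k assume k: "k \<in> K' i"
      have "(n i k)\<^sup>2 * (sgn (a i k e) \<bullet> x)\<^sup>2 = (a i k e \<bullet> x)\<^sup>2" if "e \<in> D" for e
        using norm[of i k e] i k that by (simp add: K'_def sgn_div_norm power_mult_distrib field_simps)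
      then show "(n i k)\<^sup>2 / P i * (\<Sum>c\<in>(\<lambda>e. sgn (a i k e)) ` D. (c \<bullet> x)\<^sup>2) = (\<Sum>e\<in>D. (a i k e \<bullet> x)\<^sup>2 / P i)"
        by (simp add: sum.reindex[OF inj[OF i k]] sum_distrib_left)
    qed
    also have "\<dots> = (\<Sum>k\<in>K. \<Sum>e\<in>D. (a i k e \<bullet> x)\<^sup>2 / P i)"
    proof (intro sum_K' sum.neutral ballI)
      fix k e assume "k \<in> K" "n i k = 0" "e \<in> D"
      then have "a i k e = 0" using norm[OF i, of k e] by simp
      then show "(a i k e \<bullet> x)\<^sup>2 / P i = 0" by simp
    qed
    also have "\<dots> = (\<Sum>k\<in>K. \<Sum>e\<in>D. (a i k e \<bullet> x)\<^sup>2) / P i"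
      by (simp add: sum_divide_distrib)
    finally have "3/8 * (\<Sum>l\<in>L. ((b l /\<^sub>R sqrt \<tau>) \<bullet> x)\<^sup>2) < t * ((\<Sum>k\<in>K. \<Sum>e\<in>D. (a i k e \<bullet> x)\<^sup>2) / P i)"
      using x[OF i] by simp
    moreover have "(\<Sum>l\<in>L. ((b l /\<^sub>R sqrt \<tau>) \<bullet> x)\<^sup>2) = (\<Sum>l\<in>L. (b l \<bullet> x)\<^sup>2) / \<tau>"
    proof -
      have "((b l /\<^sub>R sqrt \<tau>) \<bullet> x)\<^sup>2 = (b l \<bullet> x)\<^sup>2 / \<tau>" for l
        using posb by (simp add: \<tau>_def[symmetric] power_mult_distrib power_inverse field_simps)
      then show ?thesis by (simp add: sum_divide_distrib)
    qed
    ultimately have "3/8 * ((\<Sum>l\<in>L. (b l \<bullet> x)\<^sup>2) / \<tau>) < t * ((\<Sum>k\<in>K. \<Sum>e\<in>D. (a i k e \<bullet> x)\<^sup>2) / P i)"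
      by (simp only:)
    moreover have "P i * y < 8/3 * t * \<tau> * z" if "3/8 * (y / \<tau>) < t * (z / P i)" for y z
      using that posn[OF i] posb unfolding \<tau>_def[symmetric] P_def[symmetric] by (simp add: field_simps)
    ultimately show ?thesis by blast
  qed
  then show ?thesis unfolding P_def \<tau>_def by blast
qed

section \<open>Thresholding and rescaling\<close>

text \<open>With \<open>m = M - Q + 1\<close>, having only \<open>g \<le> Q - 1\<close> entries of
  size at least \<open>1 / m\<close> would make the sum smaller than \<open>(M - g) / m + g\<close>.
  This is at most its value at \<open>g = Q - 1\<close>, which is exactly \<open>Q\<close>.\<close>

lemma large_entries:
  fixes \<beta> :: "nat \<Rightarrow> real"
  assumes "1 \<le> Q" "Q \<le> M" and \<beta>: "\<And>i. i \<in> {1..M} \<Longrightarrow> \<beta> i \<le> 1" and sum: "(\<Sum>i=1..M. \<beta> i) = real Q"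
  shows "\<exists>I\<subseteq>{1..M}. card I = Q \<and> (\<forall>i\<in>I. 1 / real (M - Q + 1) \<le> \<beta> i)"
proof -
  define m where "m = real (M - Q + 1)"
  have m: "m \<ge> 1" "m = real M - real Q + 1" using assms(2) by (auto simp: m_def of_nat_diff)
  define G where "G = {i \<in> {1..M}. 1 / m \<le> \<beta> i}"
  have G: "G \<subseteq> {1..M}" "finite G" by (auto simp: G_def)
  have "card G \<ge> Q"
  proof (rule ccontr)
    assume "\<not> ?thesis"
    then have g: "real (card G) \<le> real Q - 1" by simp
    have cardc: "real (card ({1..M} - G)) = real M - real (card G)"
      using G by (subst card_Diff_subset) (auto simp: of_nat_diff card_mono[of "{1..M}" G, simplified])
    have ne: "{1..M} - G \<noteq> {}"
    proof
      assume e: "{1..M} - G = {}"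
      have "real M = real (card G)" using cardc unfolding e by simp
      then show False using g assms(2) by simp
    qed
    have "(\<Sum>i=1..M. \<beta> i) = (\<Sum>i\<in>{1..M} - G. \<beta> i) + (\<Sum>i\<in>G. \<beta> i)"
      using G by (intro sum.subset_diff) auto
    also have "(\<Sum>i\<in>{1..M} - G. \<beta> i) < (\<Sum>i\<in>{1..M} - G. 1 / m)"
      using ne by (intro sum_strict_mono) (auto simp: G_def not_le)
    also have "(\<Sum>i\<in>G. \<beta> i) \<le> (\<Sum>i\<in>G. 1)"
      using G \<beta> by (intro sum_mono) auto
    finally have "real Q < (real M - real (card G)) / m + real (card G)"
      using sum cardc by simp
    then have "m * real Q < real M - real (card G) + m * real (card G)"
      using m(1) by (simp add: field_simps)
    \<comment> \<open>Substituting \<open>M = m + Q - 1\<close> into the preceding strict inequality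
      says that this product is negative.\<close>
    moreover have "0 \<le> (m - 1) * (real Q - 1 - real (card G))"
      using m(1) g by (intro mult_nonneg_nonneg) auto
    ultimately show False unfolding m(2) by (simp add: algebra_simps)
  qed
  then obtain I where "I \<subseteq> G" "card I = Q" using obtain_subset_with_card_n by metis
  then show ?thesis using G by (intro exI[of _ I]) (auto simp: G_def m_def)
qed

text \<open>On the chosen \<open>Q\<close> indices \<open>T i \<ge> 1 / m\<close>, so scaling
  \<open>w\<close> to squared norm \<open>\<kappa> * m * \<tau>\<close> lifts each
  \<open>q i w\<close> to at least one; the indicator of these indices is the Boolean vector. The
  form \<open>q\<close> is abstract so that both fields are covered.\<close>

lemma rounding:
  fixes q :: "nat \<Rightarrow> 'v::real_normed_vector \<Rightarrow> real"
  assumes "1 \<le> Q" "Q \<le> M"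
    and q: "\<And>i c w. q i (c *\<^sub>R w) = c\<^sup>2 * q i w" "\<And>i w. i \<in> {1..M} \<Longrightarrow> q i w \<ge> 0"
    and \<beta>: "\<And>i. i \<in> {1..M} \<Longrightarrow> \<beta> i \<le> 1 \<and> \<beta> i \<le> T i" "(\<Sum>i=1..M. \<beta> i) = real Q"
    and "\<tau> \<ge> 0" "\<kappa> \<ge> 0"
    and key: "\<And>I. I \<subseteq> {1..M} \<Longrightarrow> card I = Q \<Longrightarrow> (\<forall>i\<in>I. T i > 0) \<Longrightarrow> \<exists>w. \<forall>i\<in>I. T i * (norm w)\<^sup>2 < \<kappa> * \<tau> * q i w"
  shows "\<exists>w \<beta>'. (\<forall>i\<in>{1..M}. \<beta>' i \<in> {0,1} \<and> q i w \<ge> \<beta>' i) \<and> (\<Sum>i=1..M. \<beta>' i) = real Q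
    \<and> (norm w)\<^sup>2 = \<kappa> * real (M - Q + 1) * \<tau>"
proof -
  define m where "m = real (M - Q + 1)"
  have m: "m > 0" by (simp add: m_def)
  obtain I where I: "I \<subseteq> {1..M}" "card I = Q" "\<And>i. i \<in> I \<Longrightarrow> 1 / m \<le> \<beta> i"
    using large_entries[of Q M \<beta>] assms(1,2) \<beta> unfolding m_def by blast
  have T: "T i \<ge> 1 / m" if "i \<in> I" for i using I(1) I(3)[OF that] \<beta>(1)[of i] that by force
  then have "T i > 0" if "i \<in> I" for i using m that by (meson divide_pos_pos less_le_trans zero_less_one)
  then obtain w where w: "\<And>i. i \<in> I \<Longrightarrow> T i * (norm w)\<^sup>2 < \<kappa> * \<tau> * q i w"
    using key[OF I(1,2)] by blast
  have "I \<noteq> {}" using I(2) assms(1) by auto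
  \<comment> \<open>At \<open>w = 0\<close> homogeneity makes both sides of the strict inequality
    vanish.\<close>
  then have "w \<noteq> 0" using w q(1)[of _ 0 0] by fastforce
  define c where "c = \<kappa> * m * \<tau> / (norm w)\<^sup>2"
  have c: "c \<ge> 0" using assms m by (simp add: c_def)
  have "1 \<le> q i (sqrt c *\<^sub>R w)" if "i \<in> I" for i
  proof -
    have "(norm w)\<^sup>2 / m \<le> T i * (norm w)\<^sup>2"
      using mult_right_mono[OF T[OF that], of "(norm w)\<^sup>2"] by simp
    also note w[OF that]
    finally have "(norm w)\<^sup>2 \<le> \<kappa> * m * \<tau> * q i w" using m by (simp add: field_simps)
    then show ?thesis using \<open>w \<noteq> 0\<close> c by (simp add: q(1)) (simp add: c_def field_simps)
  qed
  moreover have "0 \<le> q i (sqrt c *\<^sub>R w)" if "i \<in> {1..M}" for i using q(2)[OF that] .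
  moreover have "(norm (sqrt c *\<^sub>R w))\<^sup>2 = \<kappa> * m * \<tau>"
    using \<open>w \<noteq> 0\<close> c by (simp add: power_mult_distrib) (simp add: c_def)
  moreover have "(\<Sum>i=1..M. if i \<in> I then 1 else 0 :: real) = real Q"
    using I(1,2) by (simp add: sum.If_cases Int_absorb1)
  ultimately show ?thesis
    unfolding m_def[symmetric] by (intro exI[of _ "sqrt c *\<^sub>R w"] exI[of _ "\<lambda>i. if i \<in> I then 1 else 0"]) auto
qed

section \<open>Gram decompositions of positive semidefinite matrices\<close>

lemma cform_eq_sum_mult: "cform A w = (\<Sum>i\<in>UNIV. cnj (w $ i) * (A *v w) $ i)"
  by (simp add: cform_def matrix_vector_mult_def sum_distrib_left mult.assoc)

lemma matrix_vector_mult_axis: "(A *v axis p 1) $ i = (A :: 'a::comm_semiring_1^'n^'m) $ i $ p"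
  by (simp add: matrix_vector_mult_def axis_def if_distrib[of "(*) _"] cong: if_cong)

lemma hermitian_cnj: "hermitian A \<Longrightarrow> cnj (A $ i $ j) = A $ j $ i"
  unfolding hermitian_def by (erule allE[of _ j], erule allE[of _ i], rule sym)

text \<open>Varying one coordinate exposes the form as a quadratic polynomial in \<open>c\<close>. A
  vanishing leading coefficient gives \<open>psd_complex_zero_diag\<close>, and completing the
  square gives \<open>psd_complex_schur\<close>.\<close>

lemma cform_shift:
  fixes A :: "complex^'n^'n"
  assumes "hermitian A"
  shows "cform A (x - c *s axis p 1) =
    cform A x - c * cnj ((A *v x) $ p) - cnj c * (A *v x) $ p + c * cnj c * A $ p $ p"
proof -
  have mv: "(A *v (x - c *s axis p 1)) $ i = (A *v x) $ i - c * A $ i $ p" for i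
    by (simp add: matrix_vector_mult_diff_distrib vector_scalar_commute matrix_vector_mult_axis)
  have row: "(\<Sum>i\<in>UNIV. cnj (x $ i) * A $ i $ p) = cnj ((A *v x) $ p)"
    by (simp add: matrix_vector_mult_def hermitian_cnj[OF assms] mult.commute)
  have "cform A (x - c *s axis p 1)
     = (\<Sum>i\<in>UNIV. cnj (x $ i) * (A *v x) $ i - c * (cnj (x $ i) * A $ i $ p)
         - (if i = p then cnj c * (A *v x) $ i - cnj c * c * A $ i $ p else 0))"
    unfolding cform_eq_sum_mult mv
    by (intro sum.cong refl) (auto simp: axis_def algebra_simps)
  also have "\<dots> = cform A x - c * cnj ((A *v x) $ p) - (cnj c * (A *v x) $ p - cnj c * c * A $ p $ p)"
    unfolding cform_eq_sum_mult row[symmetric] by (simp add: sum_subtractf sum_distrib_left)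
  finally show ?thesis by (simp add: algebra_simps)
qed

lemma psd_complex_diag:
  assumes "psd_complex A"
  shows "Im (A $ p $ p) = 0" "Re (A $ p $ p) \<ge> 0"
proof -
  have "cform A (axis p 1) = A $ p $ p"
    unfolding cform_eq_sum_mult matrix_vector_mult_axis
    by (simp add: axis_def if_distrib[of cnj] if_distrib[of "\<lambda>c. c * _"] cong: if_cong)
  moreover have "Im (cform A (axis p 1)) = 0" "Re (cform A (axis p 1)) \<ge> 0"
    using assms by (simp_all add: psd_complex_def)
  ultimately show "Im (A $ p $ p) = 0" "Re (A $ p $ p) \<ge> 0" by simp_all
qed

text \<open>If the diagonal entry is zero, moving along that axis changes the form only linearly, so
  a nonzero entry in the row would drive it below zero.\<close>

lemma psd_complex_zero_diag:
  fixes A :: "complex^'n^'n"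
  assumes "psd_complex A" "A $ p $ p = 0"
  shows "A $ p $ j = 0"
proof (rule ccontr)
  have herm: "hermitian A" using assms(1) by (simp add: psd_complex_def)
  let ?x = "axis j 1 :: complex^'n"
  define r where "r = (A *v ?x) $ p"
  assume "A $ p $ j \<noteq> 0"
  then have r: "r \<noteq> 0" by (simp add: r_def matrix_vector_mult_axis)
  \<comment> \<open>Solves the linear equation that makes the real part of the form equal to
    \<open>-1\<close>.\<close>
  define s where "s = (Re (cform A ?x) + 1) / (2 * (cmod r)\<^sup>2)"
  have "cform A (?x - (of_real s * r) *s axis p 1) = cform A ?x - of_real (2 * s * (cmod r)\<^sup>2)"
    unfolding cform_shift[OF herm] r_def[symmetric] assms(2)
    using complex_norm_square[of r] by (simp add: algebra_simps)
  also have "2 * s * (cmod r)\<^sup>2 = Re (cform A ?x) + 1"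
    using r by (simp add: s_def)
  finally have "Re (cform A (?x - (of_real s * r) *s axis p 1)) = -1"
    by simp
  moreover have "Re (cform A (?x - (of_real s * r) *s axis p 1)) \<ge> 0"
    using assms(1) by (simp add: psd_complex_def)
  ultimately show False by simp
qed

text \<open>Completing the square: the form of the Schur complement at \<open>x\<close> is the form
  of \<open>A\<close> at \<open>x\<close> with coordinate \<open>p\<close> shifted to its
  minimiser.\<close>

lemma psd_complex_schur:
  fixes A :: "complex^'n^'n"
  assumes A: "psd_complex A" and p: "A $ p $ p \<noteq> 0"
  shows "psd_complex (\<chi> i j. A $ i $ j - A $ i $ p * A $ p $ j / A $ p $ p)" (is "psd_complex ?B")
proof -
  have herm: "hermitian A" using A by (simp add: psd_complex_def)
  note h = hermitian_cnj[OF herm]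
  have "cform ?B x = cform A (x - ((A *v x) $ p / A $ p $ p) *s axis p 1)" for x
  proof -
    define r where "r = (A *v x) $ p"
    have "cnj r = (\<Sum>i\<in>UNIV. cnj (x $ i) * A $ i $ p)"
      by (simp add: r_def matrix_vector_mult_def h mult.commute)
    then have "cnj r * r / A $ p $ p = (\<Sum>i\<in>UNIV. \<Sum>j\<in>UNIV. cnj (x $ i) * (A $ i $ p * A $ p $ j / A $ p $ p) * x $ j)"
      by (simp add: r_def matrix_vector_mult_def sum_product sum_divide_distrib mult.assoc)
    then have "cform ?B x = cform A x - cnj r * r / A $ p $ p"
      by (simp add: cform_def sum_subtractf[symmetric] left_diff_distrib right_diff_distrib)
    moreover have "cform A (x - (r / A $ p $ p) *s axis p 1) = cform A x - cnj r * r / A $ p $ p"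
      unfolding cform_shift[OF herm] r_def[symmetric] using p by (simp add: h field_simps)
    ultimately show ?thesis by (simp add: r_def)
  qed
  moreover have "hermitian ?B"
    by (simp add: hermitian_def h mult.commute)
  ultimately show ?thesis using A by (simp add: psd_complex_def)
qed

text \<open>Induction on the number of nonzero diagonal entries, each Schur complement eliminating a
  pivot. The second conjunct keeps the columns of eliminated pivots empty, so that column
  \<open>p\<close> is free when it is filled in.\<close>

lemma psd_complex_cholesky:
  fixes A :: "complex^'n^'n"
  assumes "psd_complex A"
  shows "\<exists>u :: 'n \<Rightarrow> complex^'n. (\<forall>i j. A $ i $ j = (\<Sum>k\<in>UNIV. u i $ k * cnj (u j $ k)))
    \<and> (\<forall>i k. A $ k $ k = 0 \<longrightarrow> u i $ k = 0)"
  using assms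
proof (induction "card {i. A $ i $ i \<noteq> 0}" arbitrary: A rule: less_induct)
  case less
  note A = less.prems
  have herm: "hermitian A" using A by (simp add: psd_complex_def)
  note h = hermitian_cnj[OF herm]
  show ?case
  proof (cases "\<exists>p. A $ p $ p \<noteq> 0")
    case False
    then show ?thesis using psd_complex_zero_diag[OF A] by (intro exI[of _ "\<lambda>_. 0"]) auto
  next
    case True
    then obtain p where p: "A $ p $ p \<noteq> 0" by blast
    define B where "B = (\<chi> i j. A $ i $ j - A $ i $ p * A $ p $ j / A $ p $ p)"
    have B: "psd_complex B" unfolding B_def by (rule psd_complex_schur[OF A p])
    have Bp: "B $ p $ p = 0" using p by (simp add: B_def)
    have B0: "B $ i $ i = 0" if "A $ i $ i = 0" for i
      using psd_complex_zero_diag[OF A that] that by (simp add: B_def)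
    have "{i. B $ i $ i \<noteq> 0} \<subset> {i. A $ i $ i \<noteq> 0}" using p Bp B0 by blast
    then have "card {i. B $ i $ i \<noteq> 0} < card {i. A $ i $ i \<noteq> 0}" by (simp add: psubset_card_mono)
    from less.hyps[OF this B] obtain u where u: "\<And>i j. B $ i $ j = (\<Sum>k\<in>UNIV. u i $ k * cnj (u j $ k))"
      "\<And>i k. B $ k $ k = 0 \<Longrightarrow> u i $ k = 0" by blast
    define s where "s = sqrt (Re (A $ p $ p))"
    have s: "A $ p $ p = of_real s * of_real s"
      using psd_complex_diag[OF A, of p] by (simp add: complex_eq_iff s_def)
    \<comment> \<open>Column \<open>p\<close> supplies the rank-one matrix subtracted in the Schur
      complement; the other columns come from the factor of \<open>B\<close>.\<close>
    define v where "v i = (\<chi> k. if k = p then A $ i $ p / of_real s else u i $ k)" for i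
    have "A $ i $ j = (\<Sum>k\<in>UNIV. v i $ k * cnj (v j $ k))" for i j
    proof -
      have "(\<Sum>k\<in>UNIV. v i $ k * cnj (v j $ k))
          = (\<Sum>k\<in>UNIV. u i $ k * cnj (u j $ k) + (if k = p then A $ i $ p * A $ p $ j / A $ p $ p else 0))"
        using u(2)[OF Bp] by (intro sum.cong refl) (auto simp: v_def s h)
      also have "\<dots> = B $ i $ j + A $ i $ p * A $ p $ j / A $ p $ p"
        by (simp add: sum.distrib u(1))
      finally show ?thesis by (simp add: B_def)
    qed
    moreover have "v i $ k = 0" if "A $ k $ k = 0" for i k
      using that p u(2) B0 by (auto simp: v_def)
    ultimately show ?thesis by blast
  qed
qed

text \<open>The complex factorisation is reused: its vectors, taken with the real inner product of
  \<open>complex^'n\<close>, are Gram vectors of the real matrix. That they lie in a larger space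
  does no harm, as the averaging works in any Euclidean space.\<close>

lemma psd_real_gram:
  fixes A :: "real^'n^'n"
  assumes "psd_real A"
  shows "\<exists>v :: 'n \<Rightarrow> complex^'n. \<forall>i j. A $ i $ j = v i \<bullet> v j"
proof -
  let ?C = "(\<chi> i j. of_real (A $ i $ j)) :: complex^'n^'n"
  have sym: "A $ i $ j = A $ j $ i" for i j
  proof -
    have "A $ i $ j = transpose A $ j $ i" by (simp add: transpose_def)
    then show ?thesis using assms by (simp add: psd_real_def)
  qed
  have nn: "0 \<le> (\<Sum>i\<in>UNIV. \<Sum>j\<in>UNIV. y i * A $ i $ j * y j)" for y
  proof -
    have "0 \<le> (\<chi> i. y i) \<bullet> (A *v (\<chi> i. y i))" using assms by (simp add: psd_real_def)
    then show ?thesis by (simp add: inner_vec_def matrix_vector_mult_def sum_distrib_left mult.assoc)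
  qed
  have "psd_complex ?C"
    unfolding psd_complex_def
  proof (intro conjI allI)
    show "hermitian ?C" unfolding hermitian_def using sym by simp
    fix x :: "complex^'n"
    have "Re (cform ?C x) = (\<Sum>i\<in>UNIV. \<Sum>j\<in>UNIV. Re (x $ i) * A $ i $ j * Re (x $ j))
        + (\<Sum>i\<in>UNIV. \<Sum>j\<in>UNIV. Im (x $ i) * A $ i $ j * Im (x $ j))"
      by (simp add: cform_def sum.distrib[symmetric])
    then show "Re (cform ?C x) \<ge> 0" using nn[of "\<lambda>i. Re (x $ i)"] nn[of "\<lambda>i. Im (x $ i)"] by simp
    have "Im (cform ?C x) = (\<Sum>i\<in>UNIV. \<Sum>j\<in>UNIV. Re (x $ i) * A $ i $ j * Im (x $ j))
        - (\<Sum>i\<in>UNIV. \<Sum>j\<in>UNIV. Im (x $ i) * A $ i $ j * Re (x $ j))"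
      by (simp add: cform_def sum_subtractf[symmetric])
    \<comment> \<open>The two mixed sums cancel by symmetry after exchanging the indices.\<close>
    also have "(\<Sum>i\<in>UNIV. \<Sum>j\<in>UNIV. Im (x $ i) * A $ i $ j * Re (x $ j))
        = (\<Sum>i\<in>UNIV. \<Sum>j\<in>UNIV. Re (x $ i) * A $ i $ j * Im (x $ j))"
    proof (subst sum.swap, intro sum.cong refl)
      fix i j show "Im (x $ j) * A $ j $ i * Re (x $ i) = Re (x $ i) * A $ i $ j * Im (x $ j)"
        using sym[of i j] by simp
    qed
    finally show "Im (cform ?C x) = 0" by simp
  qed
  then obtain u :: "'n \<Rightarrow> complex^'n" where u: "\<And>i j. ?C $ i $ j = (\<Sum>k\<in>UNIV. u i $ k * cnj (u j $ k))"
    using psd_complex_cholesky by blast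
  have "A $ i $ j = u i \<bullet> u j" for i j
  proof -
    have "A $ i $ j = Re (?C $ i $ j)" by simp
    then show ?thesis unfolding u by (simp add: inner_vec_def inner_complex_def)
  qed
  then show ?thesis by blast
qed

section \<open>Simultaneous lower bounds for quadratic forms\<close>

lemma sum_rotate:
  fixes f :: "'a \<Rightarrow> 'b \<Rightarrow> 'c \<Rightarrow> 'd::comm_monoid_add"
  shows "(\<Sum>i\<in>A. \<Sum>j\<in>B. \<Sum>k\<in>C. f i j k) = (\<Sum>k\<in>C. \<Sum>i\<in>A. \<Sum>j\<in>B. f i j k)"
proof -
  have "(\<Sum>i\<in>A. \<Sum>j\<in>B. \<Sum>k\<in>C. f i j k) = (\<Sum>i\<in>A. \<Sum>k\<in>C. \<Sum>j\<in>B. f i j k)"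
    by (intro sum.cong refl sum.swap)
  then show ?thesis by (simp only: sum.swap[of _ C A])
qed

text \<open>For Gram vectors \<open>h\<close> of \<open>H\<close> and \<open>v\<close> of
  \<open>X\<close> the right side is \<open>trace (H ** X)\<close>; with real scalars in place of
  \<open>v\<close> it is the value of the quadratic form of \<open>H\<close>. Both readings are
  used.\<close>

lemma sum_Basis_norm_combination:
  fixes h :: "'n::finite \<Rightarrow> 'a::euclidean_space" and v :: "'n \<Rightarrow> 'b::real_inner"
  shows "(\<Sum>e\<in>Basis. (norm (\<Sum>j\<in>UNIV. (h j \<bullet> e) *\<^sub>R v j))\<^sup>2) = (\<Sum>j\<in>UNIV. \<Sum>k\<in>UNIV. (h j \<bullet> h k) * (v j \<bullet> v k))"
proof -
  have "(\<Sum>e\<in>Basis. (norm (\<Sum>j\<in>UNIV. (h j \<bullet> e) *\<^sub>R v j))\<^sup>2)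
     = (\<Sum>e\<in>Basis. \<Sum>j\<in>UNIV. \<Sum>k\<in>UNIV. (h j \<bullet> e) * (h k \<bullet> e) * (v j \<bullet> v k))"
    unfolding power2_norm_eq_inner
    by (simp add: inner_sum_left inner_sum_right sum_distrib_left mult.assoc mult.left_commute inner_commute)
  also have "\<dots> = (\<Sum>j\<in>UNIV. \<Sum>k\<in>UNIV. \<Sum>e\<in>Basis. (h j \<bullet> e) * (h k \<bullet> e) * (v j \<bullet> v k))"
    by (rule sum_rotate[symmetric])
  also have "\<dots> = (\<Sum>j\<in>UNIV. \<Sum>k\<in>UNIV. (h j \<bullet> h k) * (v j \<bullet> v k))"
    by (intro sum.cong refl) (simp add: sum_distrib_right[symmetric] euclidean_inner[symmetric])
  finally show ?thesis .
qed

text \<open>With Gram vectors \<open>v\<close> of \<open>X\<close>, the vector of pairings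
  \<open>v l \<bullet> x\<close> has covariance \<open>X\<close> when \<open>x\<close> is standard
  Gaussian. Its norm and all the forms \<open>H i\<close> become sums of squares of linear
  functionals of \<open>x\<close>.\<close>

lemma real_simultaneous_bound:
  fixes H :: "'i \<Rightarrow> real^'n^'n"
  assumes "finite I" "I \<noteq> {}" and H: "\<And>i. i \<in> I \<Longrightarrow> psd_real (H i)" and X: "psd_real X"
    and pos: "\<And>i. i \<in> I \<Longrightarrow> trace (H i ** X) > 0"
  shows "\<exists>w. \<forall>i\<in>I. trace (H i ** X) * (norm w)\<^sup>2 < 16/3 * (real (card I))\<^sup>2 * trace X * (w \<bullet> (H i *v w))"
proof -
  obtain v :: "'n \<Rightarrow> complex^'n" where v: "\<And>i j. X $ i $ j = v i \<bullet> v j" using psd_real_gram[OF X] by blast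
  have "\<forall>i\<in>I. \<exists>h :: 'n \<Rightarrow> complex^'n. \<forall>j k. H i $ j $ k = h j \<bullet> h k" using psd_real_gram H by blast
  then obtain h :: "'i \<Rightarrow> 'n \<Rightarrow> complex^'n" where h: "\<And>i j k. i \<in> I \<Longrightarrow> H i $ j $ k = h i j \<bullet> h i k"
    by metis
  define a where "a i e = (\<Sum>j\<in>UNIV. (h i j \<bullet> e) *\<^sub>R v j)" for i and e :: "complex^'n"
  have trX: "trace X = (\<Sum>l\<in>UNIV. (norm (v l))\<^sup>2)"
    by (simp add: trace_def v power2_norm_eq_inner)
  have trHX: "(\<Sum>e\<in>Basis. (norm (a i e))\<^sup>2) = trace (H i ** X)" if "i \<in> I" for i
    unfolding a_def sum_Basis_norm_combination
    by (simp add: trace_def matrix_matrix_mult_def h[OF that] v inner_commute)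
  have posX: "trace X > 0"
  proof (rule ccontr)
    assume "\<not> ?thesis"
    then have "trace X = 0" unfolding trX using sum_nonneg[of UNIV "\<lambda>l. (norm (v l))\<^sup>2"] by simp
    then have "v l = 0" for l unfolding trX by (simp add: sum_nonneg_eq_0_iff)
    moreover obtain i where "i \<in> I" using assms(2) by blast
    ultimately show False using pos[of i] trHX[of i] by (simp add: a_def)
  qed
  \<comment> \<open>Each summand is a single real square, hence the one-element index set. Here
    \<open>t\<close> is twice the square of \<open>card I\<close>, so that
    \<open>sqrt (1 + 2 * t)\<close> exceeds \<open>2 * card I\<close>.\<close>
  have "\<exists>x. \<forall>i\<in>I. (\<Sum>e\<in>Basis. (norm (a i e))\<^sup>2) * (\<Sum>l\<in>UNIV. (v l \<bullet> x)\<^sup>2)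
    < 8/3 * (2 * (real (card I))\<^sup>2) * (\<Sum>l\<in>UNIV. (norm (v l))\<^sup>2) * (\<Sum>e\<in>Basis. \<Sum>d\<in>{()}. (a i e \<bullet> x)\<^sup>2)"
  proof (rule gauss_averaging_homogeneous)
    have "2 * real (card I) < sqrt (1 + 2 * (2 * (real (card I))\<^sup>2))"
      by (rule real_less_rsqrt) (simp add: power_mult_distrib)
    then show "2 * real (card I) < sqrt (1 + 2 * (2 * (real (card I))\<^sup>2)) ^ card {()}" by simp
  qed (use assms(1) pos trHX posX trX in auto)
  then obtain x where x: "\<And>i. i \<in> I \<Longrightarrow> trace (H i ** X) * (\<Sum>l\<in>UNIV. (v l \<bullet> x)\<^sup>2)
    < 16/3 * (real (card I))\<^sup>2 * trace X * (\<Sum>e\<in>Basis. (a i e \<bullet> x)\<^sup>2)"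
    unfolding trX by (auto simp: trHX)
  define w where "w = (\<chi> l. v l \<bullet> x)"
  have "(norm w)\<^sup>2 = (\<Sum>l\<in>UNIV. (v l \<bullet> x)\<^sup>2)"
    by (simp add: w_def norm_vec_def L2_set_def sum_nonneg)
  moreover have quad: "w \<bullet> (B *v w) = (\<Sum>j\<in>UNIV. \<Sum>k\<in>UNIV. B $ j $ k * (w $ j * w $ k))" for B
    by (simp add: inner_vec_def matrix_vector_mult_def sum_distrib_left mult_ac)
  moreover have "(\<Sum>e\<in>Basis. (a i e \<bullet> x)\<^sup>2) = w \<bullet> (H i *v w)" if "i \<in> I" for i
  proof -
    have "(\<Sum>e\<in>Basis. (a i e \<bullet> x)\<^sup>2) = (\<Sum>e\<in>Basis. (norm (\<Sum>j\<in>UNIV. (h i j \<bullet> e) *\<^sub>R (v j \<bullet> x)))\<^sup>2)"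
      by (simp add: a_def inner_sum_left)
    also have "\<dots> = (\<Sum>j\<in>UNIV. \<Sum>k\<in>UNIV. (h i j \<bullet> h i k) * ((v j \<bullet> x) \<bullet> (v k \<bullet> x)))"
      by (rule sum_Basis_norm_combination)
    also have "\<dots> = w \<bullet> (H i *v w)"
      unfolding quad by (simp add: w_def h[OF that])
    finally show ?thesis .
  qed
  ultimately show ?thesis using x by (intro exI[of _ w]) simp
qed

text \<open>\<open>cdual a True\<close> and \<open>cdual a False\<close> represent the real and imaginary parts of
  \<open>z \<mapsto> \<Sum>l. a\<^sub>l z\<^sub>l\<close> through the real inner product.\<close>

definition cdual :: "complex^'n \<Rightarrow> bool \<Rightarrow> complex^'n" where
  "cdual a e = (\<chi> l. (if e then 1 else \<i>) * cnj (a $ l))"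

lemma norm_cdual: "norm (cdual a e) = norm a"
  by (simp add: cdual_def norm_vec_def norm_mult)

lemma cdual_orthogonal: "e \<noteq> e' \<Longrightarrow> cdual a e \<bullet> cdual a e' = 0"
  by (auto simp: cdual_def inner_vec_def inner_complex_def)

lemma cmod_pairing_eq_cdual:
  "(cmod (\<Sum>l\<in>UNIV. a $ l * z $ l))\<^sup>2 = (\<Sum>e\<in>UNIV. (cdual a e \<bullet> z)\<^sup>2)"
  by (simp add: cmod_power2 UNIV_bool cdual_def inner_vec_def inner_complex_def algebra_simps)

lemma cform_gram:
  assumes "\<And>i j. A $ i $ j = (\<Sum>k\<in>UNIV. h i $ k * cnj (h j $ k))"
  shows "Re (cform A w) = (\<Sum>k\<in>UNIV. (cmod (\<Sum>j\<in>UNIV. cnj (h j $ k) * w $ j))\<^sup>2)"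
proof -
  have "complex_of_real (\<Sum>k\<in>UNIV. (cmod (\<Sum>j\<in>UNIV. cnj (h j $ k) * w $ j))\<^sup>2)
      = (\<Sum>k\<in>UNIV. cnj (\<Sum>j\<in>UNIV. cnj (h j $ k) * w $ j) * (\<Sum>j\<in>UNIV. cnj (h j $ k) * w $ j))"
    unfolding of_real_sum complex_norm_square by (simp only: mult.commute)
  also have "\<dots> = (\<Sum>k\<in>UNIV. \<Sum>i\<in>UNIV. \<Sum>j\<in>UNIV. cnj (w $ i) * (h i $ k * cnj (h j $ k)) * w $ j)"
    unfolding cnj_sum sum_product by (intro sum.cong refl) simp
  also have "\<dots> = (\<Sum>i\<in>UNIV. \<Sum>j\<in>UNIV. \<Sum>k\<in>UNIV. cnj (w $ i) * (h i $ k * cnj (h j $ k)) * w $ j)"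
    by (rule sum_rotate[symmetric])
  also have "\<dots> = cform A w"
    unfolding cform_def assms by (simp add: sum_distrib_left sum_distrib_right)
  finally have "cform A w = complex_of_real (\<Sum>k\<in>UNIV. (cmod (\<Sum>j\<in>UNIV. cnj (h j $ k) * w $ j))\<^sup>2)" by (rule sym)
  then show ?thesis by simp
qed

lemma trace_mult_gram:
  fixes X :: "complex^'n^'n"
  assumes "\<And>i j. X $ i $ j = (\<Sum>k\<in>UNIV. u i $ k * cnj (u j $ k))"
  shows "trace (A ** X) = (\<Sum>k\<in>UNIV. cform A (\<chi> j. u j $ k))"
proof -
  have "trace (A ** X) = (\<Sum>i\<in>UNIV. \<Sum>j\<in>UNIV. \<Sum>k\<in>UNIV. cnj (u i $ k) * A $ i $ j * u j $ k)"
    by (simp add: trace_def matrix_matrix_mult_def assms sum_distrib_left mult_ac)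
  also have "\<dots> = (\<Sum>k\<in>UNIV. cform A (\<chi> j. u j $ k))"
    unfolding cform_def vec_lambda_beta by (rule sum_rotate)
  finally show ?thesis .
qed

text \<open>As over the reals, but every squared modulus is a sum of two real squares along
  orthogonal vectors of equal norm. Thus \<open>d = 2\<close>, and a \<open>t\<close> linear in
  \<open>card I\<close> suffices.\<close>

lemma complex_simultaneous_bound:
  fixes H :: "'i \<Rightarrow> complex^'n^'n"
  assumes "finite I" "I \<noteq> {}" and H: "\<And>i. i \<in> I \<Longrightarrow> psd_complex (H i)" and X: "psd_complex X"
    and pos: "\<And>i. i \<in> I \<Longrightarrow> Re (trace (H i ** X)) > 0"
  shows "\<exists>w. \<forall>i\<in>I. Re (trace (H i ** X)) * (norm w)\<^sup>2 < 16/3 * real (card I) * Re (trace X) * Re (cform (H i) w)"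
proof -
  obtain u :: "'n \<Rightarrow> complex^'n" where u: "\<And>i j. X $ i $ j = (\<Sum>k\<in>UNIV. u i $ k * cnj (u j $ k))"
    using psd_complex_cholesky[OF X] by blast
  have "\<forall>i\<in>I. \<exists>h :: 'n \<Rightarrow> complex^'n. \<forall>j l. H i $ j $ l = (\<Sum>k\<in>UNIV. h j $ k * cnj (h l $ k))"
    using psd_complex_cholesky H by blast
  then obtain h :: "'i \<Rightarrow> 'n \<Rightarrow> complex^'n"
    where h: "\<And>i j l. i \<in> I \<Longrightarrow> H i $ j $ l = (\<Sum>k\<in>UNIV. h i j $ k * cnj (h i l $ k))"
    by metis
  define a where "a i k = (\<chi> l. \<Sum>j\<in>UNIV. cnj (h i j $ k) * u j $ l)" for i k
  have norm2: "(norm y)\<^sup>2 = (\<Sum>l\<in>UNIV. (cmod (y $ l))\<^sup>2)" for y :: "complex^'n"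
    by (simp add: norm_vec_def L2_set_def sum_nonneg)
  have trX: "Re (trace X) = (\<Sum>l\<in>UNIV. (norm (u l))\<^sup>2)"
    by (simp add: trace_def u norm2 cmod_power2) (simp add: power2_eq_square)
  have trHX: "(\<Sum>k\<in>UNIV. (norm (a i k))\<^sup>2) = Re (trace (H i ** X))" if "i \<in> I" for i
  proof -
    have "Re (trace (H i ** X)) = (\<Sum>l\<in>UNIV. \<Sum>k\<in>UNIV. (cmod (a i k $ l))\<^sup>2)"
      unfolding trace_mult_gram[OF u] Re_sum cform_gram[OF h[OF that]] by (simp add: a_def)
    then show ?thesis unfolding norm2 by (subst sum.swap) simp
  qed
  have posX: "Re (trace X) > 0"
  proof (rule ccontr)
    assume "\<not> ?thesis"
    then have "Re (trace X) = 0" unfolding trX using sum_nonneg[of UNIV "\<lambda>l. (norm (u l))\<^sup>2"] by simp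
    then have "u l = 0" for l unfolding trX by (simp add: sum_nonneg_eq_0_iff)
    moreover obtain i where "i \<in> I" using assms(2) by blast
    ultimately show False using pos[of i] trHX[of i] by (simp add: a_def norm2)
  qed
  have trX2: "(\<Sum>l\<in>UNIV. (norm (cdual (u (fst l)) (snd l)))\<^sup>2) = 2 * Re (trace X)"
  proof -
    have "(\<Sum>l\<in>UNIV. (norm (cdual (u (fst l)) (snd l)))\<^sup>2) = (\<Sum>j\<in>UNIV. \<Sum>e\<in>(UNIV :: bool set). (norm (u j))\<^sup>2)"
      unfolding norm_cdual sum.cartesian_product UNIV_Times_UNIV by (simp add: case_prod_unfold)
    then show ?thesis unfolding trX by (simp add: sum_distrib_left)
  qed
  \<comment> \<open>Now \<open>t = card I\<close>, since
    \<open>sqrt (1 + 2 * t) ^ 2 = 1 + 2 * t\<close>. Each row of the factor of \<open>X\<close>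
    enters twice, which doubles the trace and turns \<open>8/3\<close> into
    \<open>16/3\<close>.\<close>
  have "\<exists>x. \<forall>i\<in>I. (\<Sum>k\<in>UNIV. (norm (a i k))\<^sup>2) * (\<Sum>l\<in>UNIV. (cdual (u (fst l)) (snd l) \<bullet> x)\<^sup>2)
    < 8/3 * real (card I) * (\<Sum>l\<in>UNIV. (norm (cdual (u (fst l)) (snd l)))\<^sup>2)
      * (\<Sum>k\<in>UNIV. \<Sum>e\<in>UNIV. (cdual (a i k) e \<bullet> x)\<^sup>2)"
    by (rule gauss_averaging_homogeneous)
      (use assms(1) pos trHX posX trX2 in \<open>auto simp: norm_cdual cdual_orthogonal\<close>)
  then obtain x where x: "\<And>i. i \<in> I \<Longrightarrow> Re (trace (H i ** X)) * (\<Sum>l\<in>UNIV. (cdual (u (fst l)) (snd l) \<bullet> x)\<^sup>2)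
    < 16/3 * real (card I) * Re (trace X) * (\<Sum>k\<in>UNIV. \<Sum>e\<in>UNIV. (cdual (a i k) e \<bullet> x)\<^sup>2)"
    unfolding trX2 by (auto simp: trHX mult.assoc)
  define w where "w = (\<chi> j. \<Sum>l\<in>UNIV. u j $ l * x $ l)"
  have "(norm w)\<^sup>2 = (\<Sum>j\<in>UNIV. \<Sum>e\<in>UNIV. (cdual (u j) e \<bullet> x)\<^sup>2)"
    unfolding norm2 w_def cmod_pairing_eq_cdual[symmetric] by simp
  also have "\<dots> = (\<Sum>l\<in>UNIV. (cdual (u (fst l)) (snd l) \<bullet> x)\<^sup>2)"
    unfolding UNIV_Times_UNIV[symmetric] sum.cartesian_product by (simp add: case_prod_unfold)
  finally have "(norm w)\<^sup>2 = (\<Sum>l\<in>UNIV. (cdual (u (fst l)) (snd l) \<bullet> x)\<^sup>2)" .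
  moreover have "(\<Sum>k\<in>UNIV. \<Sum>e\<in>UNIV. (cdual (a i k) e \<bullet> x)\<^sup>2) = Re (cform (H i) w)" if "i \<in> I" for i
  proof -
    \<comment> \<open>Exchanging the sums identifies the functional given by \<open>a i k\<close>
      with the \<open>k\<close>-th component of the adjoint factor of \<open>H i\<close> applied to
      \<open>w\<close>.\<close>
    have "(\<Sum>l\<in>UNIV. a i k $ l * x $ l) = (\<Sum>j\<in>UNIV. cnj (h i j $ k) * w $ j)" for k
      unfolding a_def w_def vec_lambda_beta sum_distrib_left sum_distrib_right
      by (subst sum.swap) (simp add: mult.assoc)
    then show ?thesis
      unfolding cform_gram[OF h[OF that]] cmod_pairing_eq_cdual[symmetric] by simp
  qed
  ultimately show ?thesis using x by (intro exI[of _ w]) simp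
qed

section \<open>Comparison of the optimal values\<close>

text \<open>Passes from single feasible points to the infimum. An infeasible relaxation is included:
  the infimum is then infinite, and \<open>C > 0\<close> keeps the right side infinite.\<close>

lemma ereal_le_mult_InfI:
  fixes S :: "ereal set"
  assumes "C > 0" "\<And>y. y \<in> S \<Longrightarrow> x \<le> ereal C * y"
  shows "x \<le> ereal C * Inf S"
proof -
  have "x / ereal C \<le> Inf S"
    using assms by (intro Inf_greatest) (simp add: ereal_divide_le_pos)
  then show ?thesis using assms(1) by (simp add: ereal_divide_le_pos)
qed

lemma psd_real_trace_nonneg:
  fixes X :: "real^'n^'n"
  assumes "psd_real X" shows "trace X \<ge> 0"
proof -
  obtain v :: "'n \<Rightarrow> complex^'n" where "\<And>i j. X $ i $ j = v i \<bullet> v j" using psd_real_gram[OF assms] by blast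
  then show ?thesis by (simp add: trace_def sum_nonneg)
qed

lemma psd_complex_trace_nonneg: "psd_complex X \<Longrightarrow> Re (trace X) \<ge> 0"
  by (simp add: trace_def psd_complex_diag sum_nonneg)

lemma cform_scaleR: "cform A (c *\<^sub>R w) = of_real (c\<^sup>2) * cform A w"
  by (simp add: cform_def sum_distrib_left power2_eq_square scaleR_conv_of_real[where 'a=complex] mult_ac)

lemma vQP_real_le_vSDP2_real:
  fixes H :: "nat \<Rightarrow> real^'n^'n"
  assumes "1 \<le> Q" "Q \<le> M" and H: "\<And>i. i \<in> {1..M} \<Longrightarrow> psd_real (H i)"
    and C: "16/3 * (real Q)\<^sup>2 * real (M - Q + 1) \<le> C"
  shows "vQP_real M Q H \<le> ereal C * vSDP2_real M Q H"
  unfolding vSDP2_real_def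
proof (rule ereal_le_mult_InfI)
  have "0 < 16/3 * (real Q)\<^sup>2 * real (M - Q + 1)" using assms(1) by simp
  then show "C > 0" using C by linarith
  fix y assume "y \<in> {ereal (trace X) | X \<beta>. psd_real X \<and>
      (\<forall>i\<in>{1..M}. 0 \<le> \<beta> i \<and> \<beta> i \<le> 1 \<and> trace (H i ** X) \<ge> \<beta> i) \<and> (\<Sum>i=1..M. \<beta> i) = real Q}"
  then obtain X \<beta> where y: "y = ereal (trace X)" and X: "psd_real X"
    and \<beta>: "\<forall>i\<in>{1..M}. 0 \<le> \<beta> i \<and> \<beta> i \<le> 1 \<and> trace (H i ** X) \<ge> \<beta> i" "(\<Sum>i=1..M. \<beta> i) = real Q" by blast
  note X0 = psd_real_trace_nonneg[OF X]
  have "\<exists>w \<beta>'. (\<forall>i\<in>{1..M}. \<beta>' i \<in> {0,1} \<and> w \<bullet> (H i *v w) \<ge> \<beta>' i) \<and> (\<Sum>i=1..M. \<beta>' i) = real Q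
    \<and> (norm w)\<^sup>2 = (16/3 * (real Q)\<^sup>2) * real (M - Q + 1) * trace X"
  proof (rule rounding[where T="\<lambda>i. trace (H i ** X)" and \<beta>=\<beta>])
    show "(c *\<^sub>R w) \<bullet> (H i *v (c *\<^sub>R w)) = c\<^sup>2 * (w \<bullet> (H i *v w))" for i c and w :: "real^'n"
      by (simp add: matrix_vector_mult_scaleR power2_eq_square)
    show "w \<bullet> (H i *v w) \<ge> 0" if "i \<in> {1..M}" for i w using H[OF that] by (simp add: psd_real_def)
    fix I assume I: "I \<subseteq> {1..M}" "card I = Q" "\<forall>i\<in>I. 0 < trace (H i ** X)"
    have "finite I" using I(1) finite_subset by blast
    moreover have "I \<noteq> {}" using I(2) assms(1) by auto
    ultimately show "\<exists>w. \<forall>i\<in>I. trace (H i ** X) * (norm w)\<^sup>2 < 16/3 * (real Q)\<^sup>2 * trace X * (w \<bullet> (H i *v w))"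
      using real_simultaneous_bound[of I H X] I H X by blast
  qed (use assms \<beta> X0 in auto)
  then obtain w \<beta>' where w: "\<forall>i\<in>{1..M}. \<beta>' i \<in> {0,1} \<and> w \<bullet> (H i *v w) \<ge> \<beta>' i" "(\<Sum>i=1..M. \<beta>' i) = real Q"
    "(norm w)\<^sup>2 = (16/3 * (real Q)\<^sup>2) * real (M - Q + 1) * trace X" by blast
  have "vQP_real M Q H \<le> ereal ((norm w)\<^sup>2)"
    unfolding vQP_real_def using w(1,2) by (intro Inf_lower) blast
  also have "\<dots> \<le> ereal (C * trace X)"
    unfolding w(3) using mult_right_mono[OF C X0] by simp
  finally show "vQP_real M Q H \<le> ereal C * y" by (simp add: y)
qed

lemma vQP_complex_le_vSDP2_complex:
  fixes H :: "nat \<Rightarrow> complex^'n^'n"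
  assumes "1 \<le> Q" "Q \<le> M" and H: "\<And>i. i \<in> {1..M} \<Longrightarrow> psd_complex (H i)"
    and C: "16/3 * real Q * real (M - Q + 1) \<le> C"
  shows "vQP_complex M Q H \<le> ereal C * vSDP2_complex M Q H"
  unfolding vSDP2_complex_def
proof (rule ereal_le_mult_InfI)
  have "0 < 16/3 * real Q * real (M - Q + 1)" using assms(1) by simp
  then show "C > 0" using C by linarith
  fix y assume "y \<in> {ereal (Re (trace X)) | X \<beta>. psd_complex X \<and>
      (\<forall>i\<in>{1..M}. 0 \<le> \<beta> i \<and> \<beta> i \<le> 1 \<and> Re (trace (H i ** X)) \<ge> \<beta> i) \<and> (\<Sum>i=1..M. \<beta> i) = real Q}"
  then obtain X \<beta> where y: "y = ereal (Re (trace X))" and X: "psd_complex X"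
    and \<beta>: "\<forall>i\<in>{1..M}. 0 \<le> \<beta> i \<and> \<beta> i \<le> 1 \<and> Re (trace (H i ** X)) \<ge> \<beta> i" "(\<Sum>i=1..M. \<beta> i) = real Q" by blast
  note X0 = psd_complex_trace_nonneg[OF X]
  have "\<exists>w \<beta>'. (\<forall>i\<in>{1..M}. \<beta>' i \<in> {0,1} \<and> Re (cform (H i) w) \<ge> \<beta>' i) \<and> (\<Sum>i=1..M. \<beta>' i) = real Q
    \<and> (norm w)\<^sup>2 = (16/3 * real Q) * real (M - Q + 1) * Re (trace X)"
  proof (rule rounding[where T="\<lambda>i. Re (trace (H i ** X))" and \<beta>=\<beta>])
    show "Re (cform (H i) (c *\<^sub>R w)) = c\<^sup>2 * Re (cform (H i) w)" for i c and w :: "complex^'n"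
      unfolding cform_scaleR by (simp del: of_real_power)
    show "Re (cform (H i) w) \<ge> 0" if "i \<in> {1..M}" for i w using H[OF that] by (simp add: psd_complex_def)
    fix I assume I: "I \<subseteq> {1..M}" "card I = Q" "\<forall>i\<in>I. 0 < Re (trace (H i ** X))"
    have "finite I" using I(1) finite_subset by blast
    moreover have "I \<noteq> {}" using I(2) assms(1) by auto
    ultimately show "\<exists>w. \<forall>i\<in>I. Re (trace (H i ** X)) * (norm w)\<^sup>2 < 16/3 * real Q * Re (trace X) * Re (cform (H i) w)"
      using complex_simultaneous_bound[of I H X] I H X by blast
  qed (use assms \<beta> X0 in auto)
  then obtain w \<beta>' where w: "\<forall>i\<in>{1..M}. \<beta>' i \<in> {0,1} \<and> Re (cform (H i) w) \<ge> \<beta>' i" "(\<Sum>i=1..M. \<beta>' i) = real Q"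
    "(norm w)\<^sup>2 = (16/3 * real Q) * real (M - Q + 1) * Re (trace X)" by blast
  have "vQP_complex M Q H \<le> ereal ((norm w)\<^sup>2)"
    unfolding vQP_complex_def using w(1,2) by (intro Inf_lower) blast
  also have "\<dots> \<le> ereal (C * Re (trace X))"
    unfolding w(3) using mult_right_mono[OF C X0] by simp
  finally show "vQP_complex M Q H \<le> ereal C * y" by (simp add: y)
qed

theorem theorem2p7:
  fixes M Q :: nat
  assumes "CARD('n) \<ge> 2" and "M \<ge> 2" and "1 \<le> Q" and "Q \<le> M - 1"
  shows "(\<forall>H :: nat \<Rightarrow> real^'n^'n. (\<forall>i\<in>{1..M}. psd_real (H i)) \<longrightarrow>
            vQP_real M Q H \<le> ereal (27 * real Q ^ 2 * real (M - Q + 1) / pi) * vSDP2_real M Q H)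
       \<and> (\<forall>H :: nat \<Rightarrow> complex^'n^'n. (\<forall>i\<in>{1..M}. psd_complex (H i)) \<longrightarrow>
            vQP_complex M Q H \<le> ereal (max (8 * real Q) (24 * (sqrt (real Q) - 1)^2) * real (M - Q + 1))
                                    * vSDP2_complex M Q H)"
proof (intro conjI allI impI)
  have QM: "Q \<le> M" using assms by simp
  fix H :: "nat \<Rightarrow> real^'n^'n" assume "\<forall>i\<in>{1..M}. psd_real (H i)"
  moreover have "16/3 * (real Q)\<^sup>2 * real (M - Q + 1) \<le> 27 * real Q ^ 2 * real (M - Q + 1) / pi"
  proof -
    \<comment> \<open>The crude bound \<open>pi < 4\<close> already gives
      \<open>16/3 * pi < 64/3 < 27\<close>.\<close>
    have "16/3 * pi \<le> 27" using pi_less_4 by simp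
    then have "16/3 \<le> 27 / pi" by (simp add: field_simps)
    then have "16/3 * ((real Q)\<^sup>2 * real (M - Q + 1)) \<le> 27 / pi * ((real Q)\<^sup>2 * real (M - Q + 1))"
      by (rule mult_right_mono) simp
    then show ?thesis by (simp add: mult.assoc)
  qed
  ultimately show "vQP_real M Q H \<le> ereal (27 * real Q ^ 2 * real (M - Q + 1) / pi) * vSDP2_real M Q H"
    using vQP_real_le_vSDP2_real[OF assms(3) QM] by blast
next
  have QM: "Q \<le> M" using assms by simp
  fix H :: "nat \<Rightarrow> complex^'n^'n" assume "\<forall>i\<in>{1..M}. psd_complex (H i)"
  \<comment> \<open>Since \<open>16/3 \<le> 8\<close>, the first argument of the maximum is large
    enough for every \<open>Q\<close>.\<close>
  moreover have "16/3 * real Q * real (M - Q + 1) \<le> max (8 * real Q) (24 * (sqrt (real Q) - 1)^2) * real (M - Q + 1)"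
    by (intro mult_right_mono) auto
  ultimately show "vQP_complex M Q H \<le> ereal (max (8 * real Q) (24 * (sqrt (real Q) - 1)^2) * real (M - Q + 1)) * vSDP2_complex M Q H"
    using vQP_complex_le_vSDP2_complex[OF assms(3) QM] by blast
qed

end
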